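(* If $G$ is an almost bipartite non-König-Egerváry graph, then $\varrho_v(G)=|\mathrm{corona}(G)|-|\mathrm{diadem}(G)|$.
   Context: All graphs are finite, undirected, loopless, without multiple edges; $n(G)=|V(G)|$. $\alpha(G)$ is the maximum size of an independent set and $\mu(G)$ the maximum size of a matching. $G$ is a König-Egerváry graph if $\alpha(G)+\mu(G)=n(G)$. $G$ is almost bipartite if it has exactly one odd cycle. $\varrho_v(G)$ is the number of vertices $v\in V(G)$ such that $G-v$ is a König-Egerváry graph. $\mathrm{corona}(G)$ is the union of all maximum independent sets of $G$. For $X\subseteq V(G)$, $N_G(X)=\{v: v \text{ has a neighbor in } X\}$ and $d(X)=|X|-|N_G(X)|$; the critical difference is $d(G)=\max\{d(I): I \text{ independent in } G\}$; an independent set $A$ (possibly empty) is a critical independent set if $d(A)=d(G)$. $\mathrm{diadem}(G)$ is the union of all critical independent sets of $G$. *)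

theory Defs
  imports "Graph_Theory.Graph_Theory"
begin

text \<open>
  Finite simple undirected graphs are the members of the locale \<^locale>\<open>graph\<close>: finite symmetric
  digraphs without loops and without parallel arcs. An undirected edge is a pair of opposite arcs;
  \<open>uedges\<close> lists each such pair once, as the two-element set of its ends.
\<close>

definition uedges :: "('a,'b) pre_digraph \<Rightarrow> 'a set set" where
  "uedges G = (\<lambda>e. {tail G e, head G e}) ` arcs G"

definition independent_set :: "('a,'b) pre_digraph \<Rightarrow> 'a set \<Rightarrow> bool" where
  "independent_set G I \<longleftrightarrow> I \<subseteq> verts G \<and> (\<forall>u\<in>I. \<forall>v\<in>I. \<not> u \<rightarrow>\<^bsub>G\<^esub> v)"

definition independence_number :: "('a,'b) pre_digraph \<Rightarrow> nat" where
  "independence_number G = Max (card ` {I. independent_set G I})"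

definition matching :: "('a,'b) pre_digraph \<Rightarrow> 'a set set \<Rightarrow> bool" where
  "matching G M \<longleftrightarrow> M \<subseteq> uedges G \<and> pairwise disjnt M"

definition matching_number :: "('a,'b) pre_digraph \<Rightarrow> nat" where
  "matching_number G = Max (card ` {M. matching G M})"

definition konig_egervary :: "('a,'b) pre_digraph \<Rightarrow> bool" where
  "konig_egervary G \<longleftrightarrow> independence_number G + matching_number G = card (verts G)"

text \<open>
  \<^const>\<open>pre_digraph.cycle\<close> describes a cycle by a closed list of arcs, so one undirected cycle has
  several such descriptions (choice of starting vertex and of orientation). We identify
  a cycle with its set of undirected edges. The list \<open>u, v, u\<close> is also a
  \<^const>\<open>pre_digraph.cycle\<close>, but it has even length; in a loop-free graph an odd one has length at
  least 3.
\<close>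

definition odd_cycles :: "('a,'b) pre_digraph \<Rightarrow> 'a set set set" where
  "odd_cycles G =
    {(\<lambda>e. {tail G e, head G e}) ` set p | p. pre_digraph.cycle G p \<and> odd (length p)}"

definition almost_bipartite :: "('a,'b) pre_digraph \<Rightarrow> bool" where
  "almost_bipartite G \<longleftrightarrow> (\<exists>!C. C \<in> odd_cycles G)"

definition rho_v :: "('a,'b) pre_digraph \<Rightarrow> nat" where
  "rho_v G = card {v \<in> verts G. konig_egervary (pre_digraph.del_vert G v)}"

definition corona :: "('a,'b) pre_digraph \<Rightarrow> 'a set" where
  "corona G = \<Union> {I. independent_set G I \<and> card I = independence_number G}"

definition nbhd :: "('a,'b) pre_digraph \<Rightarrow> 'a set \<Rightarrow> 'a set" where
  "nbhd G X = {v. \<exists>x\<in>X. v \<rightarrow>\<^bsub>G\<^esub> x}"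

definition difference :: "('a,'b) pre_digraph \<Rightarrow> 'a set \<Rightarrow> int" where
  "difference G X = int (card X) - int (card (nbhd G X))"

definition critical_difference :: "('a,'b) pre_digraph \<Rightarrow> int" where
  "critical_difference G = Max (difference G ` {I. independent_set G I})"

definition critical_independent_set :: "('a,'b) pre_digraph \<Rightarrow> 'a set \<Rightarrow> bool" where
  "critical_independent_set G A \<longleftrightarrow>
    independent_set G A \<and> difference G A = critical_difference G"

definition diadem :: "('a,'b) pre_digraph \<Rightarrow> 'a set" where
  "diadem G = \<Union> {A. critical_independent_set G A}"

end

theory Submission
  imports Defs
begin

text \<open>
  The proof rests on a decomposition of the vertex set. Let \<open>Z\<close> be a critical independent set with as
  many vertices as possible, \<open>T = N(Z)\<close>, and \<open>L\<close> the set of the remaining vertices. Criticality gives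
  Hall's condition for \<open>T\<close>, hence an injection \<open>m\<close> that matches \<open>T\<close> into \<open>Z\<close>. No edge joins \<open>Z\<close> to \<open>L\<close>,
  and because \<open>Z\<close> cannot be enlarged, every nonempty independent set \<open>I \<subseteq> L\<close> has more than \<open>|I|\<close>
  neighbours in \<open>L\<close>; such a set \<open>L\<close> is called expanding below.

  An expanding set that induces a bipartite graph is empty, since each side would be smaller than the
  other. If \<open>L\<close> were empty, then \<open>Z\<close> and \<open>m\<close> would witness that \<open>G\<close> is a Koenig-Egervary graph. So
  \<open>L\<close> is not bipartite, while removing any one edge \<open>e\<close> of the unique odd cycle leaves a bipartite
  graph. Hence \<open>L\<close> is the disjoint union of two sides \<open>P\<close>, \<open>Q\<close> such that \<open>e\<close> is the only edge inside a
  side, it lies in \<open>P\<close>, and expansion forces \<open>|P| = |Q| + 1\<close>. Playing the edges of the odd cycle off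
  against each other, one finds that \<open>L\<close> behaves like an odd cycle on \<open>2h + 1\<close> vertices: each vertex of
  \<open>L\<close> lies in an independent set of size \<open>h\<close>, and the graph on \<open>L\<close> minus any vertex has a perfect
  matching. The lemma \<open>decomposition_exists\<close> collects these facts.

  In a graph with such a decomposition everything can be counted. One gets \<open>\<alpha> = |Z| + h\<close> and
  \<open>\<mu> = |T| + h\<close>, so \<open>\<alpha> + \<mu> = n - 1\<close>, and \<open>G - v\<close> is a Koenig-Egervary graph iff \<open>v\<close> is missed by some
  maximum independent set and by some maximum matching. Each vertex of \<open>L\<close> is missed by both, each
  vertex of \<open>T\<close> is covered by all maximum matchings, and each vertex of \<open>Z\<close> outside \<open>m(T)\<close> lies in all maximum
  independent sets. For \<open>t \<in> T\<close>, a maximum independent set contains exactly one of \<open>t\<close> and \<open>m(t)\<close>, so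
  \<open>m(t)\<close> is missed by one iff \<open>t \<in> corona(G)\<close>. If \<open>t \<in> corona(G)\<close>, then \<open>m(t)\<close> is missed by a maximum
  matching iff \<open>t \<notin> diadem(G)\<close>: a violation of Hall's condition for matching \<open>T\<close> without \<open>m(t)\<close> is the same
  thing as a critical independent set through \<open>t\<close>. Therefore \<open>\<rho>\<^sub>v\<close> counts
  \<open>L \<union> m(T \<inter> corona(G) - diadem(G))\<close>. Finally \<open>corona(G) = Z \<union> L \<union> (T \<inter> corona(G))\<close>,
  \<open>diadem(G) = Z \<union> (T \<inter> diadem(G))\<close> and \<open>diadem(G) \<subseteq> corona(G)\<close>, so both sides of the claim equal
  \<open>|L| + |T \<inter> corona(G)| - |T \<inter> diadem(G)|\<close>.
\<close>

section \<open>Finite sets and Hall's theorem\<close>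

text \<open>
  The classical induction on \<open>A\<close>. If some nonempty proper subset \<open>J\<close> is tight, a system of distinct
  representatives of \<open>J\<close> uses up all of \<open>N(J)\<close>, and the condition survives for \<open>A - J\<close> with \<open>N(J)\<close>
  removed. Otherwise every such subset has a spare neighbour, and any single choice \<open>a \<mapsto> b\<close> can be
  removed from the instance.
\<close>
lemma hall:
  fixes N :: "'a \<Rightarrow> 'b set"
  assumes "finite A"
    and "\<And>a. a \<in> A \<Longrightarrow> finite (N a)"
    and "\<And>J. J \<subseteq> A \<Longrightarrow> card J \<le> card (\<Union> (N ` J))"
  shows "\<exists>f. inj_on f A \<and> (\<forall>a\<in>A. f a \<in> N a)"
  using assms
proof (induction A arbitrary: N rule: finite_psubset_induct)
  case (psubset A)
  note fin = psubset.prems(1) and cond = psubset.prems(2)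
  have finU: "finite (\<Union> (N ` J))" if "J \<subseteq> A" for J
    using that fin psubset.hyps by (auto intro: finite_subset)
  show ?case
  proof (cases "A = {}")
    case True
    then show ?thesis by simp
  next
    case False
    show ?thesis
    proof (cases "\<exists>J. J \<subset> A \<and> J \<noteq> {} \<and> card (\<Union> (N ` J)) \<le> card J")
      case True
      then obtain J where J: "J \<subset> A" "J \<noteq> {}" "card (\<Union> (N ` J)) \<le> card J" by blast
      have finJ: "finite J" using J(1) psubset.hyps by (auto intro: finite_subset)
      have "\<exists>f. inj_on f J \<and> (\<forall>a\<in>J. f a \<in> N a)"
        using J(1) by (intro psubset.IH) (auto intro!: fin cond)
      then obtain f where f: "inj_on f J" "\<And>a. a \<in> J \<Longrightarrow> f a \<in> N a" by blast
      let ?N = "\<lambda>a. N a - \<Union> (N ` J)"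
      have "\<exists>g. inj_on g (A - J) \<and> (\<forall>a\<in>A - J. g a \<in> ?N a)"
      proof (rule psubset.IH)
        show "A - J \<subset> A" using J by blast
        show "finite (?N a)" if "a \<in> A - J" for a using that fin by auto
        show "card K \<le> card (\<Union> (?N ` K))" if K: "K \<subseteq> A - J" for K
        proof -
          have finK: "finite K" using K psubset.hyps by (auto intro: finite_subset)
          have "card K + card J = card (K \<union> J)"
            using K finK finJ by (subst card_Un_disjoint) auto
          also have "\<dots> \<le> card (\<Union> (N ` (K \<union> J)))"
            using K J by (intro cond) auto
          also have "\<Union> (N ` (K \<union> J)) = \<Union> (?N ` K) \<union> \<Union> (N ` J)" by auto
          also have "card \<dots> = card (\<Union> (?N ` K)) + card (\<Union> (N ` J))"
          proof (rule card_Un_disjoint)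
            show "finite (\<Union> (?N ` K))"
              using finU[of K] K by (auto intro: finite_subset[of _ "\<Union> (N ` K)"])
            show "finite (\<Union> (N ` J))" using finU J by auto
          qed auto
          finally show ?thesis using J(3) by linarith
        qed
      qed
      then obtain g where g: "inj_on g (A - J)" "\<And>a. a \<in> A - J \<Longrightarrow> g a \<in> ?N a" by blast
      let ?h = "\<lambda>a. if a \<in> J then f a else g a"
      have "inj_on ?h (J \<union> (A - J))"
      proof (rule inj_on_disjoint_Un[OF f(1) g(1)])
        show "f ` J \<inter> g ` (A - J) = {}" using f(2) g(2) by fastforce
      qed
      moreover have "J \<union> (A - J) = A" using J by blast
      ultimately have "inj_on ?h A" by simp
      moreover have "\<forall>a\<in>A. ?h a \<in> N a" using f(2) g(2) by auto
      ultimately show ?thesis by blast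
    next
      case strict: False
      obtain a where a: "a \<in> A" using False by blast
      have "card {a} \<le> card (\<Union> (N ` {a}))" using a by (intro cond) auto
      then obtain b where b: "b \<in> N a" by (cases "N a = {}") auto
      let ?N = "\<lambda>x. N x - {b}"
      have "\<exists>g. inj_on g (A - {a}) \<and> (\<forall>x\<in>A - {a}. g x \<in> ?N x)"
      proof (rule psubset.IH)
        show "A - {a} \<subset> A" using a by blast
        show "finite (?N x)" if "x \<in> A - {a}" for x using that fin by auto
        show "card K \<le> card (\<Union> (?N ` K))" if K: "K \<subseteq> A - {a}" for K
        proof (cases "K = {}")
          case False
          have "\<not> card (\<Union> (N ` K)) \<le> card K" using K a False strict by blast
          moreover have "\<Union> (?N ` K) = \<Union> (N ` K) - {b}" by auto
          moreover have "card (\<Union> (N ` K)) - 1 \<le> card (\<Union> (N ` K) - {b})"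
            using card_Diff_singleton_if[of "\<Union> (N ` K)" b] by auto
          ultimately show ?thesis by simp
        qed simp
      qed
      then obtain g where g: "inj_on g (A - {a})" "\<And>x. x \<in> A - {a} \<Longrightarrow> g x \<in> ?N x" by blast
      have "inj_on (g(a := b)) A"
        using g unfolding inj_on_def by auto
      moreover have "\<forall>x\<in>A. (g(a := b)) x \<in> N x" using g(2) b by auto
      ultimately show ?thesis by blast
    qed
  qed
qed

lemma card_le_if_disjoint_sets_meet:
  assumes "pairwise disjnt M" "finite X" "\<And>e. e \<in> M \<Longrightarrow> e \<inter> X \<noteq> {}"
  shows "card M \<le> card X"
proof -
  from assms(3) have "\<forall>e\<in>M. \<exists>x. x \<in> e \<inter> X" by blast
  then obtain r where r: "\<And>e. e \<in> M \<Longrightarrow> r e \<in> e \<inter> X" by metis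
  have "inj_on r M"
  proof (rule inj_onI)
    fix e e' assume e: "e \<in> M" "e' \<in> M" "r e = r e'"
    show "e = e'"
      using assms(1) e r[of e] r[of e'] by (auto simp: pairwise_def disjnt_def)
  qed
  moreover have "r ` M \<subseteq> X" using r by blast
  ultimately show ?thesis using assms(2) card_inj_on_le by blast
qed

lemma card_le_Suc_card_remove: "card A \<le> Suc (card (A - {x}))"
  using card_Suc_Diff1[of A x] by (cases "finite A"; cases "x \<in> A") simp_all

section \<open>Odd closed walks, two-colourings and the unique odd cycle\<close>

text \<open>
  Choose one root in each connected component and colour a vertex by whether an even walk leads
  there from its root. An edge between vertices of equal colour closes up an odd walk at the root.
\<close>
lemma two_colouring_or_odd_closed_walk:
  fixes R :: "'a rel"
  assumes "sym R"
  shows "(\<exists>\<chi>::'a \<Rightarrow> bool. \<forall>(u, v)\<in>R. \<chi> u \<noteq> \<chi> v) \<or> (\<exists>x n. odd n \<and> (x, x) \<in> R ^^ n)"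
proof (rule disjCI)
  assume noodd: "\<not> (\<exists>x n. odd n \<and> (x, x) \<in> R ^^ n)"
  have symn: "sym (R ^^ n)" for n
  proof (induction n)
    case (Suc n)
    show ?case
    proof (rule symI)
      fix x z assume "(x, z) \<in> R ^^ Suc n"
      then obtain y where "(x, y) \<in> R ^^ n" "(y, z) \<in> R" by auto
      then show "(z, x) \<in> R ^^ Suc n"
        using assms Suc by (meson relpow_Suc_I2 symD)
    qed
  qed (simp add: sym_def)
  define r where "r v = (SOME x. (x, v) \<in> R\<^sup>*)" for v
  define \<chi> where "\<chi> v \<longleftrightarrow> (\<exists>n. even n \<and> (r v, v) \<in> R ^^ n)" for v
  have rv: "(r v, v) \<in> R\<^sup>*" for v unfolding r_def by (rule someI[of _ v]) simp
  have "\<chi> u \<noteq> \<chi> v" if uv: "(u, v) \<in> R" for u v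
  proof
    assume eq: "\<chi> u = \<chi> v"
    have "(x, u) \<in> R\<^sup>* \<longleftrightarrow> (x, v) \<in> R\<^sup>*" for x
      using uv assms by (meson rtrancl.rtrancl_into_rtrancl symD)
    then have r: "r u = r v" unfolding r_def by simp
    obtain m n where m: "(r u, u) \<in> R ^^ m" and n: "(r u, v) \<in> R ^^ n" and par: "even m \<longleftrightarrow> even n"
    proof (cases "\<chi> u")
      case True
      with eq r show ?thesis using that unfolding \<chi>_def by metis
    next
      case False
      with eq r have "\<And>n. (r u, u) \<in> R ^^ n \<Longrightarrow> odd n" "\<And>n. (r u, v) \<in> R ^^ n \<Longrightarrow> odd n"
        unfolding \<chi>_def by metis+
      moreover obtain m where "(r u, u) \<in> R ^^ m" using rv rtrancl_imp_relpow by metis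
      moreover obtain n where "(r u, v) \<in> R ^^ n" using rv[of v] r rtrancl_imp_relpow by metis
      ultimately show ?thesis using that by blast
    qed
    have "(r u, v) \<in> R ^^ Suc m" using m uv by auto
    moreover have "(v, r u) \<in> R ^^ n" using n symn symD by metis
    ultimately have "(r u, r u) \<in> R ^^ (Suc m + n)" by (metis relpow_add relcompI)
    then show False using noodd par by (metis even_Suc even_add)
  qed
  then show "\<exists>\<chi>::'a \<Rightarrow> bool. \<forall>(u, v)\<in>R. \<chi> u \<noteq> \<chi> v"
    by (intro exI[of _ \<chi>]) auto
qed

text \<open>
  A shortest odd closed walk does not repeat a vertex: a repetition splits it into two shorter closed
  walks, one of which has odd length.
\<close>
lemma odd_closed_walk_imp_odd_cycle:
  assumes "\<exists>x n. odd n \<and> (x, x) \<in> R ^^ n"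
  obtains f n where "odd n" "f n = f 0" "inj_on f {..<n}" "\<And>i. i < n \<Longrightarrow> (f i, f (Suc i)) \<in> R"
proof -
  define n where "n = (LEAST n. odd n \<and> (\<exists>x. (x, x) \<in> R ^^ n))"
  have "odd n \<and> (\<exists>x. (x, x) \<in> R ^^ n)"
    unfolding n_def by (rule LeastI_ex) (use assms in blast)
  then obtain x where "odd n" and "(x, x) \<in> R ^^ n" by blast
  from this(2) obtain f where f: "f 0 = x" "f n = x" "\<And>i. i < n \<Longrightarrow> (f i, f (Suc i)) \<in> R"
    unfolding relpow_fun_conv by blast
  have least: "n \<le> k" if "odd k" "(y, y) \<in> R ^^ k" for k y
    unfolding n_def by (rule Least_le) (use that in blast)
  have walk: "(f i, f j) \<in> R ^^ (j - i)" if "i \<le> j" "j \<le> n" for i j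
    unfolding relpow_fun_conv using that f(3) by (intro exI[of _ "\<lambda>k. f (i + k)"]) auto
  have "f i \<noteq> f j" if ij: "i < j" "j < n" for i j
  proof
    assume eq: "f i = f j"
    have inner: "(f i, f i) \<in> R ^^ (j - i)" using walk[of i j] ij eq by simp
    have "(x, f i) \<in> R ^^ i" using walk[of 0 i] ij f by simp
    moreover have "(f i, x) \<in> R ^^ (n - j)" using walk[of j n] ij f eq by simp
    ultimately have outer: "(x, x) \<in> R ^^ (i + (n - j))" by (metis relpow_add relcompI)
    have "odd (j - i) \<or> odd (i + (n - j))" using \<open>odd n\<close> ij by presburger
    then show False using least[OF _ inner] least[OF _ outer] ij by linarith
  qed
  then have "inj_on f {..<n}" by (auto intro!: linorder_inj_onI)
  moreover have "f n = f 0" using f by simp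
  ultimately show ?thesis using \<open>odd n\<close> f(3) by (intro that)
qed

lemma cas_nth:
  assumes "pre_digraph.cas G u p v"
  shows "pre_digraph.awalk_verts G u p ! 0 = u"
    and "pre_digraph.awalk_verts G u p ! length p = v"
    and "i < length p \<Longrightarrow> tail G (p ! i) = pre_digraph.awalk_verts G u p ! i"
    and "i < length p \<Longrightarrow> head G (p ! i) = pre_digraph.awalk_verts G u p ! Suc i"
  using assms
proof (induction p arbitrary: u i)
  case Nil
  {case 1 then show ?case by (simp add: pre_digraph.awalk_verts.simps)}
  {case 2 then show ?case by (simp add: pre_digraph.awalk_verts.simps pre_digraph.cas.simps)}
  {case 3 then show ?case by simp}
  {case 4 then show ?case by simp}
next
  case (Cons e p)
  note simps = pre_digraph.awalk_verts.simps pre_digraph.cas.simps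
  {case 1 then show ?case by (simp add: simps)}
  {case 2 then show ?case using Cons.IH(2) by (simp add: simps)}
  {case 3 then show ?case using Cons.IH(3) by (cases i) (auto simp: simps)}
  {case 4 then show ?case using Cons.IH(1,4) by (cases i) (auto simp: simps)}
qed

lemma cas_of_nth:
  assumes "\<And>i. i < length p \<Longrightarrow> tail G (p ! i) = f i \<and> head G (p ! i) = f (Suc i)"
  shows "pre_digraph.cas G (f 0) p (f (length p)) \<and>
    pre_digraph.awalk_verts G (f 0) p = map f [0..<Suc (length p)]"
  using assms
proof (induction p arbitrary: f)
  case Nil
  show ?case by (simp add: pre_digraph.cas.simps pre_digraph.awalk_verts.simps)
next
  case (Cons e p)
  have e: "tail G e = f 0" "head G e = f (Suc 0)"
    using Cons.prems[of 0] by auto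
  have "tail G (p ! i) = (f \<circ> Suc) i \<and> head G (p ! i) = (f \<circ> Suc) (Suc i)"
    if "i < length p" for i
    using Cons.prems[of "Suc i"] that by auto
  from Cons.IH[OF this]
  have IH: "pre_digraph.cas G (f (Suc 0)) p (f (Suc (length p)))"
    "pre_digraph.awalk_verts G (f (Suc 0)) p = map (f \<circ> Suc) [0..<Suc (length p)]"
    by (simp_all del: upt_Suc)
  have "map f [0..<Suc (Suc (length p))] = f 0 # map (f \<circ> Suc) [0..<Suc (length p)]"
    by (metis list.simps(9) map_Suc_upt map_map upt_conv_Cons zero_less_Suc)
  then show ?case
    using e IH by (simp add: pre_digraph.cas.simps pre_digraph.awalk_verts.simps del: upt_Suc)
qed

context graph
begin

lemma adj_sym: "u \<rightarrow>\<^bsub>G\<^esub> v \<Longrightarrow> v \<rightarrow>\<^bsub>G\<^esub> u"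
  using arcs_ends_symmetric[OF sym_arcs] .

lemma adj_irrefl: "\<not> v \<rightarrow>\<^bsub>G\<^esub> v"
  using adj_not_same by blast

lemma uedges_iff: "e \<in> uedges G \<longleftrightarrow> (\<exists>x y. x \<rightarrow>\<^bsub>G\<^esub> y \<and> e = {x, y})"
  unfolding uedges_def arcs_ends_conv by blast

text \<open>
  Replaces arc lists by a closed enumeration \<open>f\<close> of the vertices of the cycle, in which form odd
  cycles can be compared with closed walks of a relation.
\<close>
lemma odd_cycles_iff:
  "C \<in> odd_cycles G \<longleftrightarrow> (\<exists>f n. odd n \<and> f n = f 0 \<and> inj_on f {..<n} \<and>
     (\<forall>i<n. f i \<rightarrow>\<^bsub>G\<^esub> f (Suc i)) \<and> C = (\<lambda>i. {f i, f (Suc i)}) ` {..<n})"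
  (is "?L \<longleftrightarrow> ?R")
proof
  assume ?L
  then obtain p u where C: "C = (\<lambda>e. {tail G e, head G e}) ` set p" and odd: "odd (length p)"
    and walk: "awalk u p u" and dist: "distinct (tl (awalk_verts u p))"
    unfolding odd_cycles_def cycle_def by blast
  define n f where "n = length p" and "f = (\<lambda>i. awalk_verts u p ! i)"
  have cas: "cas u p u" and arcs: "set p \<subseteq> arcs G" using walk by (auto simp: awalk_def)
  have f: "f 0 = u" "f n = u" "\<And>i. i < n \<Longrightarrow> tail G (p ! i) = f i"
    "\<And>i. i < n \<Longrightarrow> head G (p ! i) = f (Suc i)"
    using cas_nth[OF cas] by (auto simp: n_def f_def)
  have len: "length (awalk_verts u p) = Suc n" by (simp add: length_awalk_verts n_def)
  have distS: "f (Suc i) \<noteq> f (Suc j)" if "i < j" "j < n" for i j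
    using dist that len by (auto simp: distinct_conv_nth nth_tl f_def)
  have "f i \<noteq> f j" if ij: "i < j" "j < n" for i j
  proof (cases i)
    case 0
    obtain k where k: "j = Suc k" using \<open>i < j\<close> less_imp_Suc_add by blast
    obtain m where m: "n = Suc m" using \<open>j < n\<close> less_imp_Suc_add by blast
    have "f (Suc k) \<noteq> f (Suc m)" using ij k m by (intro distS) simp_all
    then show ?thesis unfolding 0 k using f(1,2) m by metis
  next
    case (Suc k)
    obtain l where l: "j = Suc l" using \<open>i < j\<close> less_imp_Suc_add by blast
    show ?thesis unfolding Suc l using ij Suc l by (intro distS) simp_all
  qed
  then have "inj_on f {..<n}" by (auto intro!: linorder_inj_onI)
  moreover have "\<forall>i<n. f i \<rightarrow>\<^bsub>G\<^esub> f (Suc i)"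
  proof (intro allI impI)
    fix i assume i: "i < n"
    show "f i \<rightarrow>\<^bsub>G\<^esub> f (Suc i)"
      using f(3,4)[OF i] arcs i n_def by (intro dominatesI[of "p ! i"]) (auto simp: arc_to_ends_def)
  qed
  moreover have "C = (\<lambda>i. {f i, f (Suc i)}) ` {..<n}"
  proof -
    have "set p = (\<lambda>i. p ! i) ` {..<n}"
      by (force simp: n_def set_conv_nth)
    then have "C = (\<lambda>i. {tail G (p ! i), head G (p ! i)}) ` {..<n}"
      unfolding C by (simp only: image_image)
    also have "\<dots> = (\<lambda>i. {f i, f (Suc i)}) ` {..<n}"
    proof (rule image_cong[OF refl])
      fix i assume "i \<in> {..<n}"
      then show "{tail G (p ! i), head G (p ! i)} = {f i, f (Suc i)}" using f(3,4)[of i] by simp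
    qed
    finally show ?thesis .
  qed
  moreover have "f n = f 0" by (simp only: f(1,2))
  moreover have "odd n" using odd by (simp add: n_def)
  ultimately have all: "odd n \<and> f n = f 0 \<and> inj_on f {..<n} \<and>
    (\<forall>i<n. f i \<rightarrow>\<^bsub>G\<^esub> f (Suc i)) \<and> C = (\<lambda>i. {f i, f (Suc i)}) ` {..<n}"
    by (intro conjI)
  show ?R
    by (rule exI[of _ f], rule exI[of _ n], rule all)
next
  assume ?R
  then obtain f n where f: "odd n" "f n = f 0" "inj_on f {..<n}" "\<And>i. i < n \<Longrightarrow> f i \<rightarrow>\<^bsub>G\<^esub> f (Suc i)"
    and C: "C = (\<lambda>i. {f i, f (Suc i)}) ` {..<n}" by blast
  have "\<forall>i\<in>{..<n}. \<exists>e. e \<in> arcs G \<and> tail G e = f i \<and> head G e = f (Suc i)"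
    using f(4) by (auto elim!: reachableE)
  then obtain e where e: "\<And>i. i < n \<Longrightarrow> e i \<in> arcs G \<and> tail G (e i) = f i \<and> head G (e i) = f (Suc i)"
    by (metis lessThan_iff)
  let ?p = "map e [0..<n]"
  have len: "length ?p = n" by simp
  have cas: "cas (f 0) ?p (f n)" and verts: "awalk_verts (f 0) ?p = map f [0..<Suc n]"
    using cas_of_nth[of ?p G f] e by (simp_all del: upt_Suc)
  have "n > 0" using f(1) by (cases n) auto
  have "f 0 \<in> verts G" using f(4)[OF \<open>n > 0\<close>] adj_in_verts by blast
  then have walk: "awalk (f 0) ?p (f 0)" using cas e f(2) by (auto simp: awalk_def)
  have dist: "distinct (tl (awalk_verts (f 0) ?p))"
  proof -
    have "tl (awalk_verts (f 0) ?p) = map f [1..<Suc n]"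
      unfolding verts using \<open>n > 0\<close> by (simp add: map_tl[symmetric] del: upt_Suc)
    moreover have "f i \<noteq> f j" if ij: "i < j" "i \<ge> 1" "j \<le> n" for i j
    proof (cases "j = n")
      case True
      then show ?thesis using inj_onD[OF f(3), of i 0] ij f(2)
        by (metis lessThan_iff not_one_le_zero less_nat_zero_code not_gr_zero)
    next
      case False
      then show ?thesis using inj_onD[OF f(3), of i j] ij by auto
    qed
    then have "inj_on f {1..<Suc n}" by (auto intro!: linorder_inj_onI)
    ultimately show ?thesis by (simp add: distinct_map del: upt_Suc)
  qed
  have "?p \<noteq> []" using \<open>n > 0\<close> by simp
  then have cycle: "cycle ?p" unfolding cycle_def
    by - (rule exI[of _ "f 0"], rule conjI[OF walk conjI[OF dist]])
  have "set ?p = e ` {..<n}" by (simp add: atLeast0LessThan)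
  then have "(\<lambda>e. {tail G e, head G e}) ` set ?p = (\<lambda>i. {tail G (e i), head G (e i)}) ` {..<n}"
    by (simp only: image_image)
  also have "\<dots> = C" unfolding C
  proof (rule image_cong[OF refl])
    fix i assume "i \<in> {..<n}"
    then show "{tail G (e i), head G (e i)} = {f i, f (Suc i)}" using e[of i] by simp
  qed
  finally have C': "C = (\<lambda>e. {tail G e, head G e}) ` set ?p" by (rule sym)
  have odd: "odd (length ?p)" using f(1) unfolding len .
  show ?L unfolding odd_cycles_def mem_Collect_eq
    by (rule exI[of _ ?p], rule conjI[OF C' conjI[OF cycle odd]])
qed

text \<open>
  For \<open>F\<close> take the edge set of the odd cycle. If an edge \<open>e \<in> F\<close> is removed, no odd cycle remains and
  the graph becomes two-colourable, so \<open>G\<close> has a colouring in which \<open>e\<close> alone can be monochromatic.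
  Since the cycle has length at least three, the neighbour \<open>y\<close> that follows \<open>x\<close> on the cycle is an end
  of the next cycle edge, which does not contain \<open>x\<close>.
\<close>
lemma unique_odd_cycle_structure:
  assumes "almost_bipartite G"
  obtains F where "F \<noteq> {}"
    and "F \<subseteq> uedges G"
    and "\<forall>e\<in>F. \<exists>\<chi>::'a \<Rightarrow> bool. \<forall>u v. u \<rightarrow>\<^bsub>G\<^esub> v \<longrightarrow> \<chi> u = \<chi> v \<longrightarrow> {u, v} = e"
    and "\<forall>e\<in>F. \<forall>x\<in>e. \<exists>e'\<in>F. x \<notin> e' \<and> (\<exists>y\<in>e'. x \<rightarrow>\<^bsub>G\<^esub> y)"
proof -
  obtain C where C: "C \<in> odd_cycles G" and uniq: "\<And>D. D \<in> odd_cycles G \<Longrightarrow> D = C"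
    using assms unfolding almost_bipartite_def Ex1_def by blast
  from C[unfolded odd_cycles_iff] obtain f n where fn: "odd n \<and> f n = f 0 \<and> inj_on f {..<n} \<and>
    (\<forall>i<n. f i \<rightarrow>\<^bsub>G\<^esub> f (Suc i)) \<and> C = (\<lambda>i. {f i, f (Suc i)}) ` {..<n}"
    by (elim exE)
  then have f: "odd n" "f n = f 0" "inj_on f {..<n}" "\<And>i. i < n \<Longrightarrow> f i \<rightarrow>\<^bsub>G\<^esub> f (Suc i)"
    and Cf: "C = (\<lambda>i. {f i, f (Suc i)}) ` {..<n}"
    by blast+
  have "n \<noteq> 1" using f(2) f(4)[of 0] adj_not_same by auto
  with f(1) have n3: "n \<ge> 3" by presburger
  show ?thesis
  proof (rule that[of C])
    show "C \<noteq> {}" using n3 Cf by (auto simp: lessThan_empty_iff)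
    show "C \<subseteq> uedges G"
    proof
      fix e assume "e \<in> C"
      then obtain i where "i < n" "e = {f i, f (Suc i)}" unfolding Cf by blast
      then show "e \<in> uedges G" unfolding uedges_iff using f(4) by blast
    qed
    show "\<forall>e\<in>C. \<exists>\<chi>::'a \<Rightarrow> bool. \<forall>u v. u \<rightarrow>\<^bsub>G\<^esub> v \<longrightarrow> \<chi> u = \<chi> v \<longrightarrow> {u, v} = e"
    proof
      fix e assume e: "e \<in> C"
      define R where "R = {(u, v). u \<rightarrow>\<^bsub>G\<^esub> v \<and> {u, v} \<noteq> e}"
      have "sym R" unfolding R_def sym_def using adj_sym by (auto simp: insert_commute)
      have "\<not> (\<exists>x n. odd n \<and> (x, x) \<in> R ^^ n)"
      proof
        assume "\<exists>x n. odd n \<and> (x, x) \<in> R ^^ n"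
        then show False
        proof (rule odd_closed_walk_imp_odd_cycle)
          fix g m
          assume g: "odd m" "g m = g 0" "inj_on g {..<m}"
            "\<And>i. i < m \<Longrightarrow> (g i, g (Suc i)) \<in> R"
          have "(\<lambda>i. {g i, g (Suc i)}) ` {..<m} \<in> odd_cycles G"
          proof -
            have "\<forall>i<m. g i \<rightarrow>\<^bsub>G\<^esub> g (Suc i)" using g(4) by (auto simp: R_def)
            with g(1-3) have all: "odd m \<and> g m = g 0 \<and> inj_on g {..<m} \<and>
              (\<forall>i<m. g i \<rightarrow>\<^bsub>G\<^esub> g (Suc i)) \<and>
              (\<lambda>i. {g i, g (Suc i)}) ` {..<m} = (\<lambda>i. {g i, g (Suc i)}) ` {..<m}"
              by (intro conjI) (simp, assumption+, simp)
            show ?thesis unfolding odd_cycles_iff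
              by (rule exI[of _ g], rule exI[of _ m], rule all)
          qed
          then have "e \<in> (\<lambda>i. {g i, g (Suc i)}) ` {..<m}" using uniq e by blast
          then show False using g(4) by (auto simp: R_def)
        qed
      qed
      then obtain \<chi> :: "'a \<Rightarrow> bool" where "\<forall>(u, v)\<in>R. \<chi> u \<noteq> \<chi> v"
        using two_colouring_or_odd_closed_walk[OF \<open>sym R\<close>] by blast
      then show "\<exists>\<chi>::'a \<Rightarrow> bool. \<forall>u v. u \<rightarrow>\<^bsub>G\<^esub> v \<longrightarrow> \<chi> u = \<chi> v \<longrightarrow> {u, v} = e"
        unfolding R_def by (intro exI[of _ \<chi>]) auto
    qed
    show "\<forall>e\<in>C. \<forall>x\<in>e. \<exists>e'\<in>C. x \<notin> e' \<and> (\<exists>y\<in>e'. x \<rightarrow>\<^bsub>G\<^esub> y)"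
    proof (intro ballI)
      fix e x assume ex: "e \<in> C" "x \<in> e"
      obtain k where k: "k < n" "x = f k \<or> x = f (Suc k)" using ex unfolding Cf by auto
      obtain i where i: "i < n" "x = f i"
      proof (cases "x = f k")
        case False
        then have x: "x = f (Suc k)" using k(2) by blast
        show ?thesis
        proof (cases "Suc k = n")
          case True
          then have "x = f 0" using x f(2) by metis
          moreover have "0 < n" using n3 by linarith
          ultimately show ?thesis using that by blast
        next
          case False
          then have "Suc k < n" using k(1) by linarith
          then show ?thesis using that x by blast
        qed
      next
        case True
        then show ?thesis using k(1) by (intro that)
      qed
      \<comment> \<open>The three consecutive positions \<open>i, j, k\<close> on the cycle are distinct because \<open>n \<ge> 3\<close>.\<close>
      define j where "j = (if Suc i = n then 0 else Suc i)"
      define k where "k = (if Suc j = n then 0 else Suc j)"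
      have jk: "j < n" "k < n" "i \<noteq> j" "i \<noteq> k"
        using i(1) n3 unfolding j_def k_def by (simp_all split: if_split)
      have fj: "f (Suc i) = f j" and fk: "f (Suc j) = f k"
        using f(2) unfolding j_def k_def by simp_all
      have "x \<rightarrow>\<^bsub>G\<^esub> f j" using f(4)[OF i(1)] i(2) fj by simp
      moreover have "x \<notin> {f j, f (Suc j)}"
      proof -
        have "f i \<noteq> f j" "f i \<noteq> f k" using jk i(1) f(3) by (auto dest: inj_onD)
        then show ?thesis using i(2) fk by simp
      qed
      moreover have "{f j, f (Suc j)} \<in> C" unfolding Cf using jk(1) by simp
      ultimately show "\<exists>e'\<in>C. x \<notin> e' \<and> (\<exists>y\<in>e'. x \<rightarrow>\<^bsub>G\<^esub> y)"
        by (intro bexI[of _ "{f j, f (Suc j)}"] conjI bexI[of _ "f j"]) simp_all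
    qed
  qed
qed

section \<open>Independent sets and matchings\<close>

lemma uedge_subset_verts: "e \<in> uedges G \<Longrightarrow> e \<subseteq> verts G"
  unfolding uedges_iff using adj_in_verts by blast

lemma card_uedge: "e \<in> uedges G \<Longrightarrow> card e = 2"
  unfolding uedges_iff by (metis adj_irrefl card_2_iff)

lemma nbhd_iff: "v \<in> nbhd G X \<longleftrightarrow> (\<exists>x\<in>X. v \<rightarrow>\<^bsub>G\<^esub> x)"
  by (simp add: nbhd_def)

lemma finite_nbhd [simp]: "finite (nbhd G X)"
  by (rule finite_subset[OF _ finite_verts]) (auto simp: nbhd_def adj_in_verts)

lemma finite_independent_set: "independent_set G I \<Longrightarrow> finite I"
  unfolding independent_set_def using finite_verts finite_subset by blast

lemma independent_set_subset: "independent_set G I \<Longrightarrow> J \<subseteq> I \<Longrightarrow> independent_set G J"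
  unfolding independent_set_def by blast

lemma finite_independent_sets: "finite {I. independent_set G I}"
  by (rule finite_subset[of _ "Pow (verts G)"]) (auto simp: independent_set_def)

lemma independent_set_empty: "independent_set G {}"
  by (simp add: independent_set_def)

lemma card_independent_set_le: "independent_set G I \<Longrightarrow> card I \<le> independence_number G"
  unfolding independence_number_def using finite_independent_sets by (intro Max_ge) auto

lemma maximum_independent_set_exists:
  obtains I where "independent_set G I" "card I = independence_number G"
proof -
  have "independence_number G \<in> card ` {I. independent_set G I}"
    unfolding independence_number_def using finite_independent_sets independent_set_empty
    by (intro Max_in) auto
  then show ?thesis using that by auto
qed

lemma finite_matching: "matching G M \<Longrightarrow> finite M"
  by (rule finite_subset[of _ "Pow (verts G)"]) (auto simp: matching_def dest: uedge_subset_verts)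

lemma finite_matchings: "finite {M. matching G M}"
  by (rule finite_subset[of _ "Pow (Pow (verts G))"])
    (auto simp: matching_def dest: uedge_subset_verts)

lemma card_matching_le: "matching G M \<Longrightarrow> card M \<le> matching_number G"
  unfolding matching_number_def using finite_matchings by (intro Max_ge) auto

lemma maximum_matching_exists:
  obtains M where "matching G M" "card M = matching_number G"
proof -
  have "matching G {}" by (simp add: matching_def)
  then have "matching_number G \<in> card ` {M. matching G M}"
    unfolding matching_number_def using finite_matchings by (intro Max_in) auto
  then show ?thesis using that by auto
qed

lemma matching_Un:
  assumes M: "matching G M" and N: "matching G N" and disj: "\<Union>M \<inter> \<Union>N = {}"
  shows "matching G (M \<union> N)" and "card (M \<union> N) = card M + card N"
proof -
  have de: "disjnt e f" if "e \<in> M" "f \<in> N" for e f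
    using that disj unfolding disjnt_def by blast
  have "pairwise disjnt (M \<union> N)"
  proof (rule pairwiseI)
    fix e f assume "e \<in> M \<union> N" "f \<in> M \<union> N" "e \<noteq> f"
    moreover have "pairwise disjnt M" "pairwise disjnt N" using M N by (simp_all add: matching_def)
    ultimately show "disjnt e f" using de[of e f] de[of f e] by (auto simp: pairwise_def disjnt_sym)
  qed
  then show "matching G (M \<union> N)" using M N by (simp add: matching_def)
  have "e \<noteq> {}" if "e \<in> M" for e
    using that M card_uedge[of e] by (auto simp: matching_def)
  then have "M \<inter> N = {}" using de unfolding disjnt_def by fastforce
  then show "card (M \<union> N) = card M + card N"
    using M N by (intro card_Un_disjoint finite_matching)
qed

lemma matching_of_injection:
  assumes inj: "inj_on g A" and adj: "\<And>a. a \<in> A \<Longrightarrow> a \<rightarrow>\<^bsub>G\<^esub> g a" and disj: "A \<inter> g ` A = {}"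
  shows "matching G ((\<lambda>a. {a, g a}) ` A)" and "card ((\<lambda>a. {a, g a}) ` A) = card A"
proof -
  have gA: "g a \<notin> A" if "a \<in> A" for a using that disj by blast
  have "pairwise disjnt ((\<lambda>a. {a, g a}) ` A)"
  proof (rule pairwiseI)
    fix e f assume "e \<in> (\<lambda>a. {a, g a}) ` A" "f \<in> (\<lambda>a. {a, g a}) ` A" "e \<noteq> f"
    then obtain a b where ab: "a \<in> A" "b \<in> A" "e = {a, g a}" "f = {b, g b}" "a \<noteq> b" by blast
    then show "disjnt e f"
      using gA[of a] gA[of b] inj_onD[OF inj, of a b] by (auto simp: disjnt_def)
  qed
  moreover have "{a, g a} \<in> uedges G" if "a \<in> A" for a
    unfolding uedges_iff using adj[OF that] by blast
  ultimately show "matching G ((\<lambda>a. {a, g a}) ` A)" unfolding matching_def by blast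
  have "inj_on (\<lambda>a. {a, g a}) A"
  proof (rule inj_onI)
    fix a b assume "a \<in> A" "b \<in> A" "{a, g a} = {b, g b}"
    then show "a = b" using gA by (metis doubleton_eq_iff)
  qed
  then show "card ((\<lambda>a. {a, g a}) ` A) = card A" by (rule card_image)
qed

text \<open>
  Every matching edge has an end outside a given independent set, and these ends are distinct.
\<close>
lemma independence_number_plus_matching_number_le:
  "independence_number G + matching_number G \<le> card (verts G)"
proof -
  obtain S where S: "independent_set G S" "card S = independence_number G"
    by (rule maximum_independent_set_exists)
  obtain M where M: "matching G M" "card M = matching_number G"
    by (rule maximum_matching_exists)
  have "card M \<le> card (verts G - S)"
  proof (rule card_le_if_disjoint_sets_meet)
    show "e \<inter> (verts G - S) \<noteq> {}" if "e \<in> M" for e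
    proof -
      have "e \<in> uedges G" using that M(1) by (auto simp: matching_def)
      then obtain x y where xy: "x \<rightarrow>\<^bsub>G\<^esub> y" "e = {x, y}"
        unfolding uedges_iff by blast
      then have "x \<notin> S \<or> y \<notin> S" using S(1) by (auto simp: independent_set_def)
      with xy show ?thesis using adj_in_verts by blast
    qed
  qed (use M(1) in \<open>auto simp: matching_def\<close>)
  moreover have "card S + card (verts G - S) = card (verts G)"
    using S(1) by (metis add.commute card_Diff_subset card_mono finite_independent_set finite_verts
      independent_set_def le_add_diff_inverse2)
  ultimately show ?thesis using S(2) M(2) by linarith
qed

lemma graph_del_vert: "graph (del_vert v)"
proof -
  interpret del: fin_digraph "del_vert v" by (rule fin_digraph_del_vert)
  show ?thesis
  proof (unfold_locales)
    show "tail (del_vert v) e \<noteq> head (del_vert v) e" if "e \<in> arcs (del_vert v)" for e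
      using that no_loops by (auto simp: del_vert_simps)
    show "e1 = e2" if "e1 \<in> arcs (del_vert v)" "e2 \<in> arcs (del_vert v)"
      "arc_to_ends (del_vert v) e1 = arc_to_ends (del_vert v) e2" for e1 e2
      using that no_multi_arcs by (auto simp: arcs_del_vert ends_del_vert)
    show "symmetric (del_vert v)"
      using sym_arcs unfolding symmetric_conv by (fastforce simp: del_vert_simps)
  qed
qed

lemma adj_del_vert: "x \<rightarrow>\<^bsub>del_vert v\<^esub> y \<longleftrightarrow> x \<rightarrow>\<^bsub>G\<^esub> y \<and> x \<noteq> v \<and> y \<noteq> v"
  by (auto simp: arcs_ends_conv del_vert_simps)

lemma independent_set_del_vert:
  "independent_set (del_vert v) I \<longleftrightarrow> independent_set G I \<and> v \<notin> I"
  unfolding independent_set_def adj_del_vert by (auto simp: verts_del_vert)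

lemma matching_del_vert: "matching (del_vert v) M \<longleftrightarrow> matching G M \<and> v \<notin> \<Union>M"
proof -
  have "e \<in> uedges (del_vert v) \<longleftrightarrow> e \<in> uedges G \<and> v \<notin> e" for e
    unfolding graph.uedges_iff[OF graph_del_vert] uedges_iff adj_del_vert by auto
  then show ?thesis unfolding matching_def by auto
qed

text \<open>
  Deleting a vertex increases neither \<open>\<alpha>\<close> nor \<open>\<mu>\<close>. So if \<open>\<alpha> + \<mu> = n - 1\<close>, the graph \<open>G - v\<close>, which has
  \<open>n - 1\<close> vertices, is a Koenig-Egervary graph iff neither number drops.
\<close>
lemma konig_egervary_del_vert_iff:
  assumes def1: "Suc (independence_number G + matching_number G) = card (verts G)"
    and v: "v \<in> verts G"
  shows "konig_egervary (del_vert v) \<longleftrightarrow>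
    (\<exists>S. independent_set G S \<and> card S = independence_number G \<and> v \<notin> S) \<and>
    (\<exists>M. matching G M \<and> card M = matching_number G \<and> v \<notin> \<Union>M)"
proof -
  interpret del: graph "del_vert v" by (rule graph_del_vert)
  obtain S where S: "independent_set G S" "v \<notin> S" "card S = independence_number (del_vert v)"
    using del.maximum_independent_set_exists by (metis independent_set_del_vert)
  obtain M where M: "matching G M" "v \<notin> \<Union>M" "card M = matching_number (del_vert v)"
    using del.maximum_matching_exists by (metis matching_del_vert)
  have le: "independence_number (del_vert v) \<le> independence_number G"
    "matching_number (del_vert v) \<le> matching_number G"
    using card_independent_set_le[OF S(1)] card_matching_le[OF M(1)] S M by simp_all
  have "card (verts (del_vert v)) = independence_number G + matching_number G"
    using v def1 by (simp add: verts_del_vert)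
  then have KE: "konig_egervary (del_vert v) \<longleftrightarrow>
    independence_number (del_vert v) = independence_number G \<and>
    matching_number (del_vert v) = matching_number G"
    unfolding konig_egervary_def using le by linarith
  have "independence_number (del_vert v) = independence_number G \<longleftrightarrow>
    (\<exists>S. independent_set G S \<and> card S = independence_number G \<and> v \<notin> S)"
    using S le(1) del.card_independent_set_le independent_set_del_vert le_antisym by metis
  moreover have "matching_number (del_vert v) = matching_number G \<longleftrightarrow>
    (\<exists>M. matching G M \<and> card M = matching_number G \<and> v \<notin> \<Union>M)"
    using M le(2) del.card_matching_le matching_del_vert le_antisym by metis
  ultimately show ?thesis using KE by simp
qed

section \<open>Critical independent sets and expanding sets\<close>

lemma difference_le_critical_difference:
  "independent_set G I \<Longrightarrow> difference G I \<le> critical_difference G"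
  unfolding critical_difference_def using finite_independent_sets by (intro Max_ge) auto

lemma critical_independent_set_exists: "\<exists>A. critical_independent_set G A"
proof -
  have "critical_difference G \<in> difference G ` {I. independent_set G I}"
    unfolding critical_difference_def using finite_independent_sets independent_set_empty
    by (intro Max_in) auto
  then show ?thesis by (auto simp: critical_independent_set_def)
qed

text \<open>
  The condition is Hall's condition with strict inequality, restricted to independent sets and with
  neighbours counted inside \<open>L\<close> only. The vertex set of a chordless odd cycle is an example.
\<close>
definition expanding_set :: "'a set \<Rightarrow> bool" where
  "expanding_set L \<longleftrightarrow> L \<subseteq> verts G \<and>
    (\<forall>I. independent_set G I \<longrightarrow> I \<subseteq> L \<longrightarrow> I \<noteq> {} \<longrightarrow> card I < card (nbhd G I \<inter> L))"

lemma expanding_setD: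
  "expanding_set L \<Longrightarrow> independent_set G I \<Longrightarrow> I \<subseteq> L \<Longrightarrow> I \<noteq> {} \<Longrightarrow> card I < card (nbhd G I \<inter> L)"
  unfolding expanding_set_def by blast

lemma expanding_set_finite: "expanding_set L \<Longrightarrow> finite L"
  unfolding expanding_set_def using finite_verts finite_subset by blast

end

section \<open>Counting in a decomposition with an expanding core\<close>

text \<open>
  The part of the structure of \<open>G\<close> that determines \<open>\<alpha>\<close>, \<open>\<mu>\<close>, the corona and the diadem. The core \<open>L\<close> plays
  the role of an odd cycle with \<open>2h + 1\<close> vertices, and \<open>m\<close> matches \<open>T\<close> into the independent set \<open>Z\<close>.
\<close>
locale odd_core_decomposition = graph G for G :: "('a, 'b) pre_digraph" (structure) +
  fixes Z T L :: "'a set" and m :: "'a \<Rightarrow> 'a" and h :: nat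
  assumes verts_eq: "verts G = Z \<union> T \<union> L"
    and disj: "Z \<inter> T = {}" "Z \<inter> L = {}" "T \<inter> L = {}"
    and Z_independent: "independent_set G Z"
    and no_edge_Z_L: "\<And>z l. z \<in> Z \<Longrightarrow> l \<in> L \<Longrightarrow> \<not> z \<rightarrow>\<^bsub>G\<^esub> l"
    and inj_m: "inj_on m T"
    and m_in: "\<And>t. t \<in> T \<Longrightarrow> m t \<in> Z"
    and m_adj: "\<And>t. t \<in> T \<Longrightarrow> t \<rightarrow>\<^bsub>G\<^esub> m t"
    and expanding_L: "expanding_set L"
    and card_L: "card L = Suc (2 * h)"
    and half_through: "\<And>c. c \<in> L \<Longrightarrow> \<exists>I. independent_set G I \<and> I \<subseteq> L \<and> card I = h \<and> c \<in> I"
    and near_perfect: "\<And>c. c \<in> L \<Longrightarrow> \<exists>M. matching G M \<and> \<Union>M \<subseteq> L - {c} \<and> card M = h"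
begin

lemma finite_parts [simp]: "finite Z" "finite T" "finite L"
  using finite_verts verts_eq by (metis finite_Un)+

lemma no_edge_L_Z: "l \<in> L \<Longrightarrow> z \<in> Z \<Longrightarrow> \<not> l \<rightarrow>\<^bsub>G\<^esub> z"
  using no_edge_Z_L adj_sym by blast

lemma no_edge_Z_Z: "z \<in> Z \<Longrightarrow> z' \<in> Z \<Longrightarrow> \<not> z \<rightarrow>\<^bsub>G\<^esub> z'"
  using Z_independent by (auto simp: independent_set_def)

text \<open>
  By expansion an independent subset of \<open>L\<close> is smaller than its neighbourhood in \<open>L\<close>, from which it is
  disjoint.
\<close>
lemma independent_card_L:
  assumes "independent_set G S"
  shows "card (S \<inter> L) \<le> h"
proof (cases "S \<inter> L = {}")
  case False
  have ind: "independent_set G (S \<inter> L)" using assms independent_set_subset by blast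
  have "card (S \<inter> L) < card (nbhd G (S \<inter> L) \<inter> L)"
    using expanding_setD[OF expanding_L ind _ False] by blast
  moreover have "card (S \<inter> L) + card (nbhd G (S \<inter> L) \<inter> L) \<le> card L"
  proof (subst card_Un_disjoint[symmetric])
    show "(S \<inter> L) \<inter> (nbhd G (S \<inter> L) \<inter> L) = {}"
      using ind by (auto simp: nbhd_iff independent_set_def)
    show "card (S \<inter> L \<union> nbhd G (S \<inter> L) \<inter> L) \<le> card L"
      by (rule card_mono) auto
  qed auto
  ultimately show ?thesis using card_L by linarith
qed simp

text \<open>
  An independent set through a neighbour of \<open>c\<close> avoids \<open>c\<close>.
\<close>
lemma half_avoiding:
  assumes "c \<in> L"
  obtains I where "independent_set G I" "I \<subseteq> L" "card I = h" "c \<notin> I"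
proof -
  have c: "independent_set G {c}"
    using assms verts_eq adj_irrefl by (auto simp: independent_set_def)
  have "card {c} < card (nbhd G {c} \<inter> L)" using expanding_setD[OF expanding_L c] assms by simp
  then have "nbhd G {c} \<inter> L \<noteq> {}" by (intro notI) simp
  then obtain d where d: "d \<in> L" "d \<rightarrow>\<^bsub>G\<^esub> c"
    by (auto simp: nbhd_iff)
  obtain I where I: "independent_set G I" "I \<subseteq> L" "card I = h" "d \<in> I"
    using half_through[OF d(1)] by blast
  have "c \<notin> I" using I(1,4) d(2) by (auto simp: independent_set_def)
  with I(1-3) show ?thesis by (rule that)
qed

lemma L_nonempty: "L \<noteq> {}"
  using card_L by auto

text \<open>
  The retraction of \<open>Z \<union> T\<close> onto \<open>Z\<close> along the matching edges. It is injective on independent sets,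
  which therefore meet \<open>Z \<union> T\<close> in at most \<open>|Z|\<close> vertices.
\<close>
definition proj :: "'a \<Rightarrow> 'a" where
  "proj x = (if x \<in> T then m x else x)"

lemma proj_image: "proj ` (S \<inter> (Z \<union> T)) \<subseteq> Z"
  using m_in by (auto simp: proj_def)

lemma inj_on_proj:
  assumes "independent_set G S"
  shows "inj_on proj (S \<inter> (Z \<union> T))"
proof -
  have "m x \<noteq> y" if "x \<in> S" "x \<in> T" "y \<in> S" for x y
    using assms that m_adj[of x] by (auto simp: independent_set_def)
  then show ?thesis using inj_m unfolding inj_on_def proj_def by auto
qed

lemma independent_card_ZT:
  assumes "independent_set G S"
  shows "card (S \<inter> (Z \<union> T)) \<le> card Z"
  using card_inj_on_le[OF inj_on_proj[OF assms] proj_image] by simp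

lemma card_split:
  assumes "S \<subseteq> verts G"
  shows "card S = card (S \<inter> (Z \<union> T)) + card (S \<inter> L)"
proof -
  have "S = S \<inter> (Z \<union> T) \<union> S \<inter> L" using assms verts_eq by blast
  moreover have "(S \<inter> (Z \<union> T)) \<inter> (S \<inter> L) = {}" using disj by blast
  moreover have "finite (S \<inter> (Z \<union> T))" "finite (S \<inter> L)" by auto
  ultimately show ?thesis by (metis card_Un_disjoint)
qed

lemma independent_set_Un_half:
  assumes A: "independent_set G A" "A \<subseteq> Z \<union> T" "nbhd G A \<inter> L = {}"
    and I: "independent_set G I" "I \<subseteq> L" "card I = h"
  shows "independent_set G (A \<union> I)" "card (A \<union> I) = card A + h"
proof -
  have "\<not> x \<rightarrow>\<^bsub>G\<^esub> y \<and> \<not> y \<rightarrow>\<^bsub>G\<^esub> x" if "x \<in> A" "y \<in> I" for x y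
    using that A(3) I(2) adj_sym unfolding nbhd_def by blast
  then show "independent_set G (A \<union> I)"
    using A(1) I(1) unfolding independent_set_def by blast
  have "A \<inter> I = {}" using A(2) I(2) disj by blast
  then show "card (A \<union> I) = card A + h"
    using A(1) I finite_independent_set card_Un_disjoint by metis
qed

lemma nbhd_Z: "nbhd G Z \<subseteq> T"
proof
  fix v assume "v \<in> nbhd G Z"
  then obtain z where z: "z \<in> Z" "v \<rightarrow>\<^bsub>G\<^esub> z" unfolding nbhd_iff by blast
  then have "v \<in> Z \<union> T \<union> L" "v \<notin> Z" "v \<notin> L"
    using no_edge_Z_Z no_edge_L_Z adj_in_verts(1)[OF z(2)] verts_eq by auto
  then show "v \<in> T" by blast
qed

lemma independence_number_eq: "independence_number G = card Z + h"
proof (rule antisym)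
  obtain S where S: "independent_set G S" "card S = independence_number G"
    by (rule maximum_independent_set_exists)
  have "S \<subseteq> verts G" using S(1) by (simp add: independent_set_def)
  from card_split[OF this] show "independence_number G \<le> card Z + h"
    using independent_card_L[OF S(1)] independent_card_ZT[OF S(1)] S(2) by linarith
next
  obtain c where "c \<in> L" using L_nonempty by blast
  then obtain I where I: "independent_set G I" "I \<subseteq> L" "card I = h" by (rule half_avoiding)
  have "nbhd G Z \<inter> L = {}" using nbhd_Z disj by blast
  from independent_set_Un_half[OF Z_independent _ this I]
  show "card Z + h \<le> independence_number G"
    using card_independent_set_le by (metis Un_upper1)
qed

text \<open>
  Both summands of the bound \<open>|Z| + h\<close> must be attained, so the retraction maps a maximum independent
  set onto \<open>Z\<close>.
\<close>
lemma maximum_independent_set_cases: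
  assumes S: "independent_set G S" "card S = independence_number G" and z: "z \<in> Z"
  shows "z \<in> S \<or> (\<exists>t\<in>T \<inter> S. m t = z)"
proof -
  have "S \<subseteq> verts G" using S(1) by (simp add: independent_set_def)
  from card_split[OF this] have "card (S \<inter> (Z \<union> T)) = card Z"
    using independent_card_L[OF S(1)] independent_card_ZT[OF S(1)] S(2) independence_number_eq
    by linarith
  then have "card (proj ` (S \<inter> (Z \<union> T))) = card Z"
    using card_image[OF inj_on_proj[OF S(1)]] by simp
  then have "proj ` (S \<inter> (Z \<union> T)) = Z"
    using card_subset_eq[OF _ proj_image] by simp
  then obtain x where "x \<in> S" "x \<in> Z \<union> T" "z = proj x" using z by blast
  then show ?thesis by (auto simp: proj_def split: if_splits)
qed

text \<open>
  Upper bound for matchings by a vertex cover of the edges outside \<open>L\<close>; at most \<open>h\<close> disjoint edges fit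
  into the \<open>2h + 1\<close> vertices of \<open>L\<close>. It is used with \<open>X = T\<close> for \<open>\<mu>\<close> itself, and with smaller covers to
  see that matchings avoiding certain vertices are not maximum.
\<close>
lemma card_matching_le_cover:
  assumes M: "matching G M" and X: "finite X"
    and cover: "\<And>e. e \<in> M \<Longrightarrow> e \<inter> X \<noteq> {} \<or> e \<subseteq> L"
  shows "card M \<le> card X + h"
proof -
  let ?A = "{e \<in> M. e \<inter> X \<noteq> {}}" and ?B = "{e \<in> M. e \<inter> X = {}}"
  have fin: "finite M" using M by (rule finite_matching)
  have pw: "pairwise disjnt M" and sub: "M \<subseteq> uedges G" using M by (auto simp: matching_def)
  have "card ?A \<le> card X"
    using pairwise_subset[OF pw, of ?A] X by (intro card_le_if_disjoint_sets_meet) auto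
  moreover have "2 * card ?B \<le> card L"
  proof -
    have "card (\<Union>?B) = sum card ?B"
    proof (rule card_Union_disjoint)
      show "disjoint ?B" by (rule pairwise_subset[OF pw]) blast
      show "finite e" if "e \<in> ?B" for e
      proof (rule finite_subset[OF _ finite_verts])
        show "e \<subseteq> verts G" using that sub by (intro uedge_subset_verts) auto
      qed
    qed
    also have "\<dots> = sum (\<lambda>_. 2) ?B" using sub card_uedge by (intro sum.cong) auto
    finally have "card (\<Union>?B) = 2 * card ?B" by simp
    moreover have "\<Union>?B \<subseteq> L" using cover by blast
    ultimately show ?thesis using card_mono[of L "\<Union>?B"] by simp
  qed
  then have "card ?B \<le> h" using card_L by linarith
  moreover have "card M = card ?A + card ?B"
  proof -
    have "card (?A \<union> ?B) = card ?A + card ?B" using fin by (intro card_Un_disjoint) auto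
    moreover have "?A \<union> ?B = M" by blast
    ultimately show ?thesis by simp
  qed
  ultimately show ?thesis by linarith
qed

lemma edge_meets_T_or_in_L:
  assumes "matching G M" "e \<in> M"
  shows "e \<inter> T \<noteq> {} \<or> e \<subseteq> L"
proof -
  have "e \<in> uedges G" using assms by (auto simp: matching_def)
  then obtain x y where xy: "x \<rightarrow>\<^bsub>G\<^esub> y" "e = {x, y}" unfolding uedges_iff by blast
  have "x \<in> Z \<union> T \<union> L" "y \<in> Z \<union> T \<union> L" using adj_in_verts[OF xy(1)] verts_eq by simp_all
  moreover have "x \<in> Z \<Longrightarrow> y \<in> T" "y \<in> Z \<Longrightarrow> x \<in> T"
    using calculation no_edge_Z_Z[of x y] no_edge_Z_L[of x y] no_edge_L_Z[of x y] xy(1) by auto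
  ultimately show ?thesis unfolding xy(2) by auto
qed

text \<open>
  The form in which all maximum matchings are constructed: \<open>T\<close> is matched into \<open>Z\<close>, except that one
  vertex of \<open>T\<close> may use a vertex \<open>l\<close> of \<open>L\<close>, and \<open>L - {l}\<close> is matched perfectly.
\<close>
lemma matching_from_injection:
  assumes g: "inj_on g T" "\<And>t. t \<in> T \<Longrightarrow> g t \<in> insert l Z" "\<And>t. t \<in> T \<Longrightarrow> t \<rightarrow>\<^bsub>G\<^esub> g t"
    and l: "l \<in> L"
  obtains M where "matching G M" "card M = card T + h" "\<Union>M \<subseteq> T \<union> g ` T \<union> (L - {l})"
proof -
  obtain N where N: "matching G N" "\<Union>N \<subseteq> L - {l}" "card N = h"
    using near_perfect[OF l] by blast
  let ?E = "(\<lambda>t. {t, g t}) ` T"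
  have "T \<inter> g ` T = {}" using g(2) l disj by blast
  note E = matching_of_injection[OF g(1,3) this]
  have UE: "\<Union>?E = T \<union> g ` T" by blast
  have "g ` T \<subseteq> insert l Z" using g(2) by blast
  then have "(T \<union> g ` T) \<inter> (L - {l}) = {}" using disj by blast
  then have "\<Union>?E \<inter> \<Union>N = {}" unfolding UE using N(2) by blast
  note U = matching_Un[OF E(1) N(1) this]
  have "\<Union>(?E \<union> N) \<subseteq> T \<union> g ` T \<union> (L - {l})"
    unfolding Union_Un_distrib UE using N(2) by blast
  moreover have "card (?E \<union> N) = card T + h" using U(2) E(2) N(3) by simp
  ultimately show ?thesis using U(1) by (intro that)
qed

lemma matching_number_eq: "matching_number G = card T + h"
proof (rule antisym)
  obtain M where M: "matching G M" "card M = matching_number G"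
    by (rule maximum_matching_exists)
  show "matching_number G \<le> card T + h"
    using card_matching_le_cover[OF M(1) finite_parts(2) edge_meets_T_or_in_L[OF M(1)]] M(2) by simp
next
  obtain l where "l \<in> L" using L_nonempty by blast
  then obtain M where "matching G M" "card M = card T + h"
    using matching_from_injection[OF inj_m _ m_adj] m_in by (metis insertI2)
  then show "card T + h \<le> matching_number G" using card_matching_le by metis
qed

lemma Suc_independence_plus_matching: "Suc (independence_number G + matching_number G) = card (verts G)"
proof -
  have "card (verts G) = card (Z \<union> T) + card L"
    unfolding verts_eq using disj by (intro card_Un_disjoint) auto
  also have "card (Z \<union> T) = card Z + card T"
    using disj by (intro card_Un_disjoint) auto
  finally show ?thesis
    using card_L independence_number_eq matching_number_eq by simp
qed

lemma card_nbhd_parts: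
  "card (nbhd G I) = card (nbhd G I \<inter> Z) + card (nbhd G I \<inter> T) + card (nbhd G I \<inter> L)"
proof -
  have "nbhd G I \<subseteq> verts G" by (auto simp: nbhd_iff adj_in_verts)
  from card_split[OF this]
  have "card (nbhd G I) = card (nbhd G I \<inter> (Z \<union> T)) + card (nbhd G I \<inter> L)" .
  also have "card (nbhd G I \<inter> (Z \<union> T)) = card (nbhd G I \<inter> Z) + card (nbhd G I \<inter> T)"
  proof -
    have "nbhd G I \<inter> (Z \<union> T) = (nbhd G I \<inter> Z) \<union> (nbhd G I \<inter> T)" by blast
    moreover have "(nbhd G I \<inter> Z) \<inter> (nbhd G I \<inter> T) = {}" using disj by blast
    ultimately show ?thesis by (metis card_Un_disjoint finite_Int finite_parts(1,2))
  qed
  finally show ?thesis .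
qed

lemma m_image_subset_nbhd: "m ` (I \<inter> T) \<subseteq> nbhd G I \<inter> Z"
proof
  fix z assume "z \<in> m ` (I \<inter> T)"
  then obtain t where t: "t \<in> I" "t \<in> T" "z = m t" by blast
  then show "z \<in> nbhd G I \<inter> Z" using m_in adj_sym[OF m_adj[OF t(2)]] by (auto simp: nbhd_iff)
qed

lemma card_m_image: "A \<subseteq> T \<Longrightarrow> card (m ` A) = card A"
  using card_image inj_on_subset[OF inj_m] by blast

lemma card_Int_T_le: "card (I \<inter> T) \<le> card (nbhd G I \<inter> Z)"
  using card_mono[OF _ m_image_subset_nbhd, of I] card_m_image[of "I \<inter> T"] by simp

text \<open>
  All but \<open>|Z| - |T|\<close> vertices of \<open>Z\<close> are matched by \<open>m\<close>, and the partner of a vertex of \<open>I \<inter> Z\<close> is a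
  neighbour of \<open>I\<close>.
\<close>
lemma card_Int_Z_le: "card (I \<inter> Z) + card T \<le> card (nbhd G I \<inter> T) + card Z"
proof -
  let ?B = "{t \<in> T. m t \<in> I}"
  have "?B \<subseteq> nbhd G I \<inter> T"
    unfolding nbhd_def using m_adj by blast
  then have B: "card ?B \<le> card (nbhd G I \<inter> T)" by (intro card_mono) auto
  have "card (I \<inter> Z) \<le> card (m ` ?B \<union> (Z - m ` T))"
    by (rule card_mono) auto
  also have "\<dots> \<le> card (m ` ?B) + card (Z - m ` T)" by (rule card_Un_le)
  also have "card (m ` ?B) = card ?B" by (rule card_m_image) blast
  also have "card (Z - m ` T) = card Z - card T"
    using m_in card_m_image[of T] by (subst card_Diff_subset) auto
  finally have "card (I \<inter> Z) \<le> card ?B + (card Z - card T)" .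
  moreover have "card T \<le> card Z"
    using card_inj_on_le[OF inj_m] m_in by (metis finite_parts(1) image_subsetI)
  ultimately show ?thesis using B by linarith
qed

lemma card_Int_L_le:
  assumes "independent_set G I"
  shows "card (I \<inter> L) \<le> card (nbhd G I \<inter> L)"
    and "I \<inter> L \<noteq> {} \<Longrightarrow> card (I \<inter> L) < card (nbhd G I \<inter> L)"
proof -
  show less: "card (I \<inter> L) < card (nbhd G I \<inter> L)" if "I \<inter> L \<noteq> {}"
  proof -
    have "card (I \<inter> L) < card (nbhd G (I \<inter> L) \<inter> L)"
      using expanding_setD[OF expanding_L independent_set_subset[OF assms] _ that] by blast
    also have "\<dots> \<le> card (nbhd G I \<inter> L)"
      by (rule card_mono) (auto simp: nbhd_iff)
    finally show ?thesis .
  qed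
  show "card (I \<inter> L) \<le> card (nbhd G I \<inter> L)"
    using less by (cases "I \<inter> L = {}") auto
qed

lemma card_parts:
  assumes "independent_set G I"
  shows "card I = card (I \<inter> Z) + card (I \<inter> T) + card (I \<inter> L)"
proof -
  have "I \<subseteq> verts G" using assms by (simp add: independent_set_def)
  from card_split[OF this]
  have "card I = card (I \<inter> (Z \<union> T)) + card (I \<inter> L)" .
  also have "card (I \<inter> (Z \<union> T)) = card (I \<inter> Z) + card (I \<inter> T)"
  proof -
    have "I \<inter> (Z \<union> T) = (I \<inter> Z) \<union> (I \<inter> T)" by blast
    moreover have "(I \<inter> Z) \<inter> (I \<inter> T) = {}" using disj by blast
    ultimately show ?thesis by (metis card_Un_disjoint finite_Int finite_parts(1,2))
  qed
  finally show ?thesis .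
qed

text \<open>
  The parts of \<open>I\<close> in \<open>Z\<close>, \<open>T\<close> and \<open>L\<close> are compared with the parts of \<open>N(I)\<close> in \<open>T\<close>, \<open>Z\<close> and \<open>L\<close>.
\<close>
lemma difference_le:
  assumes "independent_set G I"
  shows "difference G I \<le> int (card Z) - int (card T)"
  using card_parts[OF assms] card_nbhd_parts[of I] card_Int_T_le[of I] card_Int_Z_le[of I]
    card_Int_L_le(1)[OF assms]
  unfolding difference_def by linarith

lemma critical_independent_setI:
  assumes "independent_set G I" "card Z + card (nbhd G I) \<le> card I + card T"
  shows "critical_independent_set G I"
proof -
  have ge: "int (card Z) - int (card T) \<le> difference G I"
    using assms(2) unfolding difference_def by linarith
  obtain A where A: "independent_set G A" "difference G A = critical_difference G"
    using critical_independent_set_exists by (auto simp: critical_independent_set_def)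
  have "difference G I = critical_difference G"
    using ge difference_le[OF A(1)] A(2) difference_le_critical_difference[OF assms(1)] by linarith
  then show ?thesis using assms(1) by (simp add: critical_independent_set_def)
qed

lemma critical_Z: "critical_independent_set G Z"
proof (rule critical_independent_setI[OF Z_independent])
  show "card Z + card (nbhd G Z) \<le> card Z + card T"
    using card_mono[OF _ nbhd_Z] by simp
qed

text \<open>
  For a critical set the three comparisons behind \<open>difference_le\<close> are equalities. In \<open>L\<close> this is only
  possible if \<open>I\<close> does not meet \<open>L\<close>.
\<close>
lemma critical_structure:
  assumes "critical_independent_set G I"
  shows "independent_set G I" "I \<inter> L = {}" "nbhd G I \<inter> L = {}"
    and "nbhd G I \<inter> Z = m ` (I \<inter> T)"
proof -
  show ind: "independent_set G I" using assms by (simp add: critical_independent_set_def)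
  have "difference G Z \<le> difference G I"
    using assms critical_Z by (simp add: critical_independent_set_def)
  moreover have "difference G Z \<ge> int (card Z) - int (card T)"
    using card_mono[OF _ nbhd_Z] unfolding difference_def by simp
  ultimately have crit: "int (card Z) - int (card T) \<le> int (card I) - int (card (nbhd G I))"
    unfolding difference_def by linarith
  note bounds = card_parts[OF ind] card_nbhd_parts[of I] card_Int_T_le[of I] card_Int_Z_le[of I]
    card_Int_L_le(1)[OF ind]
  have eqs: "card (I \<inter> L) = card (nbhd G I \<inter> L)" "card (I \<inter> T) = card (nbhd G I \<inter> Z)"
    using crit bounds by linarith+
  show L: "I \<inter> L = {}" using eqs(1) card_Int_L_le(2)[OF ind] by linarith
  have "card (nbhd G I \<inter> L) = 0" using eqs(1) L by simp
  then show "nbhd G I \<inter> L = {}" by simp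
  have "m ` (I \<inter> T) = nbhd G I \<inter> Z"
    using eqs(2) card_m_image[of "I \<inter> T"] by (intro card_subset_eq m_image_subset_nbhd) auto
  then show "nbhd G I \<inter> Z = m ` (I \<inter> T)" by (rule sym)
qed

text \<open>
  All neighbours of \<open>I\<close> in \<open>Z\<close> are partners of \<open>I \<inter> T\<close>. Exchanging them for \<open>I \<inter> T\<close> in \<open>Z\<close> keeps the
  size \<open>|Z|\<close>, and the result has no neighbours in \<open>L\<close>, so half of \<open>L\<close> can be added.
\<close>
lemma critical_extends_to_maximum:
  assumes "critical_independent_set G I"
  obtains S where "independent_set G S" "card S = independence_number G" "I \<subseteq> S"
proof -
  note crit = critical_structure[OF assms]
  \<comment> \<open>The vertices of \<open>I \<inter> Z\<close> are in the second part, since \<open>N(I) \<inter> Z = m(I \<inter> T)\<close>.\<close>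
  let ?A = "(I \<inter> T) \<union> (Z - m ` (I \<inter> T))"
  have sub: "I \<subseteq> Z \<union> T \<union> L" using crit(1) verts_eq by (simp add: independent_set_def)
  have IZ: "I \<inter> Z \<inter> nbhd G I = {}"
    using crit(1) by (auto simp: independent_set_def nbhd_iff)
  have I_sub: "I \<subseteq> ?A" using sub crit(2,4) IZ by blast
  have adjIZ: "\<not> z \<rightarrow>\<^bsub>G\<^esub> t" if "z \<in> Z - m ` (I \<inter> T)" "t \<in> I" for z t
    using that crit(4) unfolding nbhd_def by blast
  have ind: "independent_set G ?A"
    unfolding independent_set_def
  proof (intro conjI ballI)
    show "?A \<subseteq> verts G" using verts_eq by blast
    fix x y assume xy: "x \<in> ?A" "y \<in> ?A"
    show "\<not> x \<rightarrow>\<^bsub>G\<^esub> y"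
    proof (cases "x \<in> I \<inter> T")
      case True
      then show ?thesis
        using xy(2) crit(1) adjIZ[of y x] adj_sym[of x y] by (auto simp: independent_set_def)
    next
      case x: False
      show ?thesis
      proof (cases "y \<in> I \<inter> T")
        case True
        then show ?thesis using x xy(1) adjIZ[of x y] by auto
      next
        case False
        then show ?thesis using x xy no_edge_Z_Z by auto
      qed
    qed
  qed
  have nA: "nbhd G ?A \<inter> L = {}"
  proof -
    have "\<not> l \<rightarrow>\<^bsub>G\<^esub> x" if "l \<in> L" "x \<in> ?A" for l x
    proof (cases "x \<in> I")
      case True
      then show ?thesis using crit(3) that(1) unfolding nbhd_def by blast
    next
      case False
      then show ?thesis using no_edge_L_Z that by blast
    qed
    then show ?thesis unfolding nbhd_def by blast
  qed
  have "card ?A = card (I \<inter> T) + card (Z - m ` (I \<inter> T))"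
    using disj by (intro card_Un_disjoint) auto
  also have "card (Z - m ` (I \<inter> T)) = card Z - card (m ` (I \<inter> T))"
    using m_in by (intro card_Diff_subset) auto
  also have "card (m ` (I \<inter> T)) = card (I \<inter> T)" by (rule card_m_image) blast
  finally have "card ?A = card (I \<inter> T) + (card Z - card (I \<inter> T))" .
  moreover have "card (I \<inter> T) \<le> card Z"
    using card_mono[of Z "m ` (I \<inter> T)"] m_in card_m_image[of "I \<inter> T"] by auto
  ultimately have cA: "card ?A = card Z" by linarith
  obtain c where "c \<in> L" using L_nonempty by blast
  then obtain J where J: "independent_set G J" "J \<subseteq> L" "card J = h" by (rule half_avoiding)
  have "?A \<subseteq> Z \<union> T" by blast
  from independent_set_Un_half[OF ind this nA J]
  have "independent_set G (?A \<union> J)" "card (?A \<union> J) = independence_number G"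
    using cA independence_number_eq by simp_all
  moreover have "I \<subseteq> ?A \<union> J" using I_sub by blast
  ultimately show ?thesis by (rule that)
qed

lemma diadem_subset_corona: "diadem G \<subseteq> corona G"
proof
  fix v assume "v \<in> diadem G"
  then obtain I where I: "critical_independent_set G I" "v \<in> I" by (auto simp: diadem_def)
  obtain S where "independent_set G S" "card S = independence_number G" "I \<subseteq> S"
    using I(1) by (rule critical_extends_to_maximum)
  then show "v \<in> corona G" using I(2) unfolding corona_def by blast
qed

lemma diadem_eq: "diadem G = Z \<union> (T \<inter> diadem G)"
proof -
  have "Z \<subseteq> diadem G" using critical_Z unfolding diadem_def by blast
  moreover have "diadem G \<subseteq> Z \<union> T"
  proof
    fix v assume "v \<in> diadem G"
    then obtain I where I: "critical_independent_set G I" "v \<in> I" by (auto simp: diadem_def)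
    have "v \<in> Z \<union> T \<union> L"
      using critical_structure(1)[OF I(1)] I(2) verts_eq by (auto simp: independent_set_def)
    then show "v \<in> Z \<union> T" using critical_structure(2)[OF I(1)] I(2) by blast
  qed
  ultimately show ?thesis by blast
qed

lemma maximum_with_half:
  assumes "independent_set G J" "J \<subseteq> L" "card J = h"
  shows "independent_set G (Z \<union> J)" "card (Z \<union> J) = independence_number G"
proof -
  have "nbhd G Z \<inter> L = {}" using nbhd_Z disj by blast
  from independent_set_Un_half[OF Z_independent _ this assms]
  show "independent_set G (Z \<union> J)" "card (Z \<union> J) = independence_number G"
    using independence_number_eq by auto
qed

lemma corona_eq: "corona G = Z \<union> L \<union> (T \<inter> corona G)"
proof -
  have "L \<subseteq> corona G"
  proof
    fix c assume "c \<in> L"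
    then obtain J where J: "independent_set G J" "J \<subseteq> L" "card J = h" "c \<in> J"
      using half_through by blast
    then show "c \<in> corona G" using maximum_with_half[OF J(1-3)] unfolding corona_def by blast
  qed
  moreover have "Z \<subseteq> corona G"
    using critical_Z diadem_subset_corona unfolding diadem_def by blast
  moreover have "corona G \<subseteq> Z \<union> T \<union> L"
    using verts_eq unfolding corona_def independent_set_def by blast
  ultimately show ?thesis by blast
qed

lemma avoidable_by_independent_iff:
  assumes t: "t \<in> T"
  shows "(\<exists>S. independent_set G S \<and> card S = independence_number G \<and> m t \<notin> S) \<longleftrightarrow> t \<in> corona G"
proof
  assume "\<exists>S. independent_set G S \<and> card S = independence_number G \<and> m t \<notin> S"
  then obtain S where S: "independent_set G S" "card S = independence_number G" "m t \<notin> S" by blast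
  obtain t' where "t' \<in> T" "t' \<in> S" "m t' = m t"
    using maximum_independent_set_cases[OF S(1,2) m_in[OF t]] S(3) by blast
  then have "t \<in> S" using inj_onD[OF inj_m _ _ t, of t'] by simp
  then show "t \<in> corona G" using S unfolding corona_def by blast
next
  assume "t \<in> corona G"
  then obtain S where S: "independent_set G S" "card S = independence_number G" "t \<in> S"
    unfolding corona_def by blast
  then have "m t \<notin> S" using m_adj[OF t] by (auto simp: independent_set_def)
  then show "\<exists>S. independent_set G S \<and> card S = independence_number G \<and> m t \<notin> S"
    using S by blast
qed

text \<open>
  If a critical set \<open>I\<close> contains \<open>t\<close>, the vertices of \<open>J = I \<inter> T\<close> have their neighbours in \<open>m(J)\<close> and in
  \<open>T - J\<close>. In a matching that avoids \<open>m(t)\<close> they can be replaced in the cover \<open>T\<close> by \<open>m(J) - {m(t)}\<close>,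
  which is one vertex smaller.
\<close>
lemma not_avoidable_by_matching:
  assumes t: "t \<in> T" "t \<in> diadem G" and M: "matching G M" "m t \<notin> \<Union>M"
  shows "card M \<noteq> matching_number G"
proof -
  obtain I where I: "critical_independent_set G I" "t \<in> I" using t(2) by (auto simp: diadem_def)
  note crit = critical_structure[OF I(1)]
  let ?J = "I \<inter> T"
  \<comment> \<open>The cover of the edges outside \<open>L\<close>, with \<open>|T| - 1\<close> vertices.\<close>
  let ?X = "(T - ?J) \<union> (m ` ?J - {m t})"
  have "card M \<le> card ?X + h"
  proof (rule card_matching_le_cover[OF M(1)])
    fix e assume e: "e \<in> M"
    then have "e \<in> uedges G" using M(1) by (auto simp: matching_def)
    then obtain a b where ab: "a \<rightarrow>\<^bsub>G\<^esub> b" "e = {a, b}" unfolding uedges_iff by blast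
    have other: "y \<in> ?X" if "x \<in> ?J" "x \<rightarrow>\<^bsub>G\<^esub> y" "y \<in> e" for x y
    proof -
      have y: "y \<in> nbhd G I" using that(1) adj_sym[OF that(2)] by (auto simp: nbhd_iff)
      have "y \<in> Z \<union> T \<union> L" using adj_in_verts(2)[OF that(2)] verts_eq by simp
      moreover have "y \<notin> L" using y crit(3) by blast
      moreover have "y \<notin> I" using that(1,2) crit(1) by (auto simp: independent_set_def)
      moreover have "y \<in> Z \<Longrightarrow> y \<in> m ` ?J" using y crit(4) by blast
      moreover have "y \<noteq> m t" using that(3) e M(2) by blast
      ultimately show ?thesis by blast
    qed
    show "e \<inter> ?X \<noteq> {} \<or> e \<subseteq> L"
    proof (cases "a \<in> ?J \<or> b \<in> ?J")
      case True
      then have "a \<in> ?X \<or> b \<in> ?X"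
        using other[of a b] other[of b a] ab adj_sym[OF ab(1)] by auto
      then show ?thesis unfolding ab(2) by auto
    next
      case False
      have "e \<inter> T \<noteq> {} \<or> e \<subseteq> L" using edge_meets_T_or_in_L[OF M(1) e] .
      then show ?thesis using False unfolding ab(2) by auto
    qed
  qed auto
  moreover have "card ?X < card T"
  proof -
    have tJ: "t \<in> ?J" using t I by blast
    have "card ?X \<le> card (T - ?J) + card (m ` ?J - {m t})" by (rule card_Un_le)
    moreover have "card (T - ?J) = card T - card ?J" by (intro card_Diff_subset) auto
    moreover have "card (m ` ?J - {m t}) = card ?J - 1"
      using tJ card_m_image[of ?J] by (subst card_Diff_singleton) auto
    moreover have "card ?J \<le> card T" by (rule card_mono) auto
    moreover have "card ?J > 0" using tJ by (subst card_gt_0_iff) auto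
    ultimately show ?thesis by linarith
  qed
  ultimately show ?thesis using matching_number_eq by linarith
qed

text \<open>
  Exchanging \<open>m(J)\<close> for \<open>J\<close> in \<open>Z\<close> changes neither the size of the set nor the bound \<open>|T|\<close> on the size
  of its neighbourhood.
\<close>
lemma critical_from_tight_set:
  assumes J: "independent_set G J" "J \<subseteq> T" "nbhd G J \<inter> L = {}" "nbhd G J \<inter> Z \<subseteq> m ` J"
  shows "critical_independent_set G (J \<union> (Z - m ` J))"
proof (rule critical_independent_setI)
  have no: "\<not> z \<rightarrow>\<^bsub>G\<^esub> t" "\<not> t \<rightarrow>\<^bsub>G\<^esub> z" if "z \<in> Z - m ` J" "t \<in> J" for z t
  proof -
    show "\<not> z \<rightarrow>\<^bsub>G\<^esub> t" using that J(4) unfolding nbhd_def by blast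
    then show "\<not> t \<rightarrow>\<^bsub>G\<^esub> z" using adj_sym by blast
  qed
  show "independent_set G (J \<union> (Z - m ` J))"
    unfolding independent_set_def
  proof (intro conjI ballI)
    show "J \<union> (Z - m ` J) \<subseteq> verts G" using J(2) verts_eq by blast
    fix x y assume xy: "x \<in> J \<union> (Z - m ` J)" "y \<in> J \<union> (Z - m ` J)"
    then consider "x \<in> J" "y \<in> J" | "x \<in> J" "y \<in> Z - m ` J" | "x \<in> Z - m ` J" "y \<in> J"
      | "x \<in> Z" "y \<in> Z" by blast
    then show "\<not> x \<rightarrow>\<^bsub>G\<^esub> y"
    proof cases
      case 1
      then show ?thesis using J(1) by (auto simp: independent_set_def)
    next
      case 2
      then show ?thesis using no(2) by blast
    next
      case 3
      then show ?thesis using no(1) by blast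
    next
      case 4
      then show ?thesis by (rule no_edge_Z_Z)
    qed
  qed
  have cJ: "card (m ` J) = card J" using J(2) by (rule card_m_image)
  have finJ: "finite J" using finite_subset[OF J(2)] by simp
  have mJ: "m ` J \<subseteq> Z" using m_in J(2) by blast
  have "nbhd G (J \<union> (Z - m ` J)) \<subseteq> (T - J) \<union> m ` J"
  proof
    fix v assume "v \<in> nbhd G (J \<union> (Z - m ` J))"
    then obtain x where x: "x \<in> J \<union> (Z - m ` J)" "v \<rightarrow>\<^bsub>G\<^esub> x" unfolding nbhd_iff by blast
    have v: "v \<in> Z \<union> T \<union> L" using adj_in_verts(1)[OF x(2)] verts_eq by simp
    show "v \<in> (T - J) \<union> m ` J"
    proof (cases "x \<in> J")
      case True
      then have "v \<in> nbhd G J" using x(2) unfolding nbhd_def by blast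
      moreover have "v \<notin> J" using True x(2) J(1) by (auto simp: independent_set_def)
      ultimately show ?thesis using v J(3,4) by blast
    next
      case False
      then have xZ: "x \<in> Z - m ` J" using x(1) by blast
      then have "v \<in> nbhd G Z" using x(2) unfolding nbhd_def by blast
      then have "v \<in> T" using nbhd_Z by blast
      moreover have "v \<notin> J" using no(2)[OF xZ] x(2) by blast
      ultimately show ?thesis by blast
    qed
  qed
  then have "card (nbhd G (J \<union> (Z - m ` J))) \<le> card ((T - J) \<union> m ` J)"
    using finJ by (intro card_mono) auto
  also have "\<dots> \<le> card (T - J) + card (m ` J)" by (rule card_Un_le)
  also have "card (T - J) = card T - card J" using finJ J(2) by (intro card_Diff_subset)
  finally have 1: "card (nbhd G (J \<union> (Z - m ` J))) \<le> card T"
    using cJ card_mono[OF finite_parts(2) J(2)] by linarith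
  have "card (J \<union> (Z - m ` J)) = card J + card (Z - m ` J)"
    using finJ J(2) disj by (intro card_Un_disjoint) auto
  also have "card (Z - m ` J) = card Z - card (m ` J)"
    using finJ mJ by (intro card_Diff_subset) auto
  finally have "card (J \<union> (Z - m ` J)) = card Z"
    using cJ card_mono[OF finite_parts(1) mJ] by linarith
  with 1 show "card Z + card (nbhd G (J \<union> (Z - m ` J))) \<le> card (J \<union> (Z - m ` J)) + card T"
    by linarith
qed

text \<open>
  There may be edges inside \<open>J\<close>. Intersecting it with a maximum independent set \<open>S\<close> that
  contains \<open>t\<close> repairs this and keeps tightness: a neighbour \<open>m(u)\<close> of \<open>J \<inter> S\<close> is not in \<open>S\<close>, and then
  its partner \<open>u\<close> is.
\<close>
lemma tight_set_corona_imp_diadem: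
  assumes J: "J \<subseteq> T" "nbhd G J \<inter> L = {}" "nbhd G J \<inter> Z = m ` J"
    and t: "t \<in> J" "t \<in> corona G"
  shows "t \<in> diadem G"
proof -
  obtain S where S: "independent_set G S" "card S = independence_number G" "t \<in> S"
    using t(2) unfolding corona_def by blast
  have sub: "nbhd G (J \<inter> S) \<subseteq> nbhd G J" unfolding nbhd_def by blast
  have "nbhd G (J \<inter> S) \<inter> Z \<subseteq> m ` (J \<inter> S)"
  proof
    fix z assume z: "z \<in> nbhd G (J \<inter> S) \<inter> Z"
    then have "z \<in> m ` J" using sub J(3) by blast
    then obtain u where u: "u \<in> J" "z = m u" by blast
    have "z \<notin> S" using z S(1) unfolding nbhd_def independent_set_def by blast
    then obtain t' where t': "t' \<in> T" "t' \<in> S" "m t' = z"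
      using maximum_independent_set_cases[OF S(1,2)] z by blast
    have "t' = u" using inj_onD[OF inj_m _ t'(1), of u] t'(3) u J(1) by auto
    then show "z \<in> m ` (J \<inter> S)" using u t'(2) by blast
  qed
  moreover have "independent_set G (J \<inter> S)" using S(1) independent_set_subset by blast
  moreover have "J \<inter> S \<subseteq> T" "nbhd G (J \<inter> S) \<inter> L = {}" using J(1,2) sub by blast+
  ultimately have "critical_independent_set G ((J \<inter> S) \<union> (Z - m ` (J \<inter> S)))"
    by (intro critical_from_tight_set)
  moreover have "t \<in> (J \<inter> S) \<union> (Z - m ` (J \<inter> S))" using t(1) S(3) by blast
  ultimately show ?thesis unfolding diadem_def by blast
qed

text \<open>
  Hall's theorem for matching \<open>T\<close> into \<open>Z - {m(t)}\<close> together with one token \<open>l0\<close>, which stands for any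
  vertex of \<open>L\<close>: only one vertex of \<open>T\<close> may be matched into \<open>L\<close>, because \<open>L\<close> minus a single vertex still
  has a perfect matching. Since \<open>m\<close> matches \<open>T\<close> into \<open>Z\<close>, a set \<open>J\<close> violating Hall's condition has no
  neighbour in \<open>L\<close>, contains \<open>t\<close> and satisfies \<open>N(J) \<inter> Z = m(J)\<close>; this puts \<open>t\<close> into the diadem.
\<close>
lemma avoidable_by_matching:
  assumes t: "t \<in> T" "t \<in> corona G" "t \<notin> diadem G"
  obtains M where "matching G M" "card M = matching_number G" "m t \<notin> \<Union>M"
proof -
  obtain l0 where l0: "l0 \<in> L" using L_nonempty by blast
  define N where "N u = (nbhd G {u} \<inter> Z - {m t}) \<union> (if nbhd G {u} \<inter> L = {} then {} else {l0})" for u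
  have "\<exists>g. inj_on g T \<and> (\<forall>u\<in>T. g u \<in> N u)"
  proof (rule hall)
    show "finite (N u)" for u unfolding N_def by auto
    show "card J \<le> card (\<Union> (N ` J))" if J: "J \<subseteq> T" for J
    proof (rule ccontr)
      let ?U = "\<Union> (N ` J)"
      assume "\<not> card J \<le> card ?U"
      then have less: "card ?U < card J" by simp
      have finJ: "finite J" using finite_subset[OF J] by simp
      have finU: "finite ?U" using finJ unfolding N_def by auto
      have cJ: "card (m ` J) = card J" using J by (rule card_m_image)
      have mJ: "m ` J \<subseteq> nbhd G J \<inter> Z"
        using m_image_subset_nbhd[of J] J by (simp add: Int_absorb2)
      have ZU: "nbhd G J \<inter> Z - {m t} \<subseteq> ?U"
      proof
        fix z assume z: "z \<in> nbhd G J \<inter> Z - {m t}"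
        then obtain u where u: "u \<in> J" "z \<rightarrow>\<^bsub>G\<^esub> u" by (auto simp: nbhd_iff)
        then have "z \<in> N u" using z by (simp add: N_def nbhd_iff)
        with u(1) show "z \<in> ?U" by (rule UN_I)
      qed
      have noL: "nbhd G J \<inter> L = {}"
      proof (rule ccontr)
        assume "nbhd G J \<inter> L \<noteq> {}"
        then obtain l u where u: "l \<in> L" "u \<in> J" "l \<rightarrow>\<^bsub>G\<^esub> u" by (auto simp: nbhd_iff)
        then have "l \<in> nbhd G {u} \<inter> L" by (simp add: nbhd_iff)
        then have "l0 \<in> N u" unfolding N_def by auto
        then have "l0 \<in> ?U" using u(2) by (rule UN_I[rotated])
        moreover have "m ` J - {m t} \<subseteq> ?U"
          by (rule subset_trans[OF Diff_mono[OF mJ subset_refl] ZU])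
        ultimately have "insert l0 (m ` J - {m t}) \<subseteq> ?U" by (rule insert_subsetI)
        then have "card (insert l0 (m ` J - {m t})) \<le> card ?U" by (rule card_mono[OF finU])
        moreover have "l0 \<notin> m ` J - {m t}" using l0 mJ disj by blast
        moreover have "card (m ` J) \<le> Suc (card (m ` J - {m t}))"
          by (rule card_le_Suc_card_remove)
        ultimately show False using less cJ finJ by simp
      qed
      have tJ: "t \<in> J"
      proof (rule ccontr)
        assume "t \<notin> J"
        then have "m t \<notin> m ` J" using inj_on_image_mem_iff[OF inj_m t(1) J] by blast
        then have "m ` J \<subseteq> nbhd G J \<inter> Z - {m t}" using mJ by blast
        from this ZU have "m ` J \<subseteq> ?U" by (rule subset_trans)
        then show False using less cJ card_mono[OF finU] by (metis not_less)
      qed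
      have "m ` J = nbhd G J \<inter> Z"
      proof (rule card_seteq[OF _ mJ])
        have "card (nbhd G J \<inter> Z) \<le> Suc (card (nbhd G J \<inter> Z - {m t}))"
          by (rule card_le_Suc_card_remove)
        also have "\<dots> \<le> Suc (card ?U)" using card_mono[OF finU ZU] by simp
        finally show "card (nbhd G J \<inter> Z) \<le> card (m ` J)" using less cJ by linarith
      qed simp
      then have "t \<in> diadem G" by (intro tight_set_corona_imp_diadem[OF J noL _ tJ t(2)]) (rule sym)
      then show False using t(3) by blast
    qed
  qed simp
  then obtain g where g: "inj_on g T" "\<And>u. u \<in> T \<Longrightarrow> g u \<in> N u" by blast
  obtain l where l: "l \<in> L" "\<And>u. u \<in> T \<Longrightarrow> g u = l0 \<Longrightarrow> u \<rightarrow>\<^bsub>G\<^esub> l"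
  proof (cases "\<exists>u\<in>T. g u = l0")
    case True
    then obtain u where u: "u \<in> T" "g u = l0" by blast
    then have "l0 \<in> N u" using g(2) by metis
    then have "nbhd G {u} \<inter> L \<noteq> {}" using l0 disj unfolding N_def by (auto split: if_splits)
    then obtain l where l: "l \<in> L" "l \<rightarrow>\<^bsub>G\<^esub> u" unfolding nbhd_def by blast
    have "v = u" if "v \<in> T" "g v = l0" for v using inj_onD[OF g(1) _ that(1) u(1)] u(2) that(2) by simp
    then show ?thesis using that[of l] l adj_sym by blast
  next
    case False
    then show ?thesis using that[of l0] l0 by blast
  qed
  \<comment> \<open>The token is replaced by the vertex of \<open>L\<close> that it stands for.\<close>
  define g' where "g' u = (if g u = l0 then l else g u)" for u
  have gZ: "g u \<in> Z \<and> g u \<noteq> m t \<and> u \<rightarrow>\<^bsub>G\<^esub> g u" if "u \<in> T" "g u \<noteq> l0" for u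
    using g(2)[OF that(1)] that(2) adj_sym unfolding N_def nbhd_def by (auto split: if_splits)
  have lZ: "l \<notin> Z" using l(1) disj by blast
  have inj: "inj_on g' T"
  proof (rule inj_onI)
    fix u v assume uv: "u \<in> T" "v \<in> T" "g' u = g' v"
    then have "g u = g v" using gZ[of u] gZ[of v] lZ unfolding g'_def by (auto split: if_splits)
    then show "u = v" using inj_onD[OF g(1)] uv by blast
  qed
  have in': "g' u \<in> insert l Z" and adj': "u \<rightarrow>\<^bsub>G\<^esub> g' u" and ne': "g' u \<noteq> m t" if "u \<in> T" for u
    using gZ[OF that] l(2)[OF that] lZ m_in[OF t(1)] unfolding g'_def by auto
  obtain M where M: "matching G M" "card M = card T + h" "\<Union>M \<subseteq> T \<union> g' ` T \<union> (L - {l})"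
    by (rule matching_from_injection[OF inj in' adj' l(1)])
  have "m t \<notin> T" "m t \<notin> L" using m_in[OF t(1)] disj by blast+
  moreover have "m t \<notin> g' ` T" using ne' by (metis imageE)
  ultimately have "m t \<notin> T \<union> g' ` T \<union> (L - {l})" by blast
  then have "m t \<notin> \<Union>M" by (rule contra_subsetD[OF M(3)])
  moreover have "card M = matching_number G" using M(2) matching_number_eq by simp
  ultimately show ?thesis using M(1) by (intro that)
qed

lemma konig_egervary_deletions:
  "{v \<in> verts G. konig_egervary (del_vert v)} = L \<union> m ` (T \<inter> corona G - diadem G)" (is "?K = _")
proof -
  have K: "v \<in> ?K \<longleftrightarrow>
    (\<exists>S. independent_set G S \<and> card S = independence_number G \<and> v \<notin> S) \<and>
    (\<exists>M. matching G M \<and> card M = matching_number G \<and> v \<notin> \<Union>M)" if "v \<in> verts G" for v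
    using konig_egervary_del_vert_iff[OF Suc_independence_plus_matching that] that by simp
  have inL: "v \<in> ?K" if v: "v \<in> L" for v
  proof -
    obtain J where J: "independent_set G J" "J \<subseteq> L" "card J = h" "v \<notin> J"
      using v by (rule half_avoiding)
    have "v \<notin> Z \<union> J" using J(4) v disj by blast
    then have S: "\<exists>S. independent_set G S \<and> card S = independence_number G \<and> v \<notin> S"
      using maximum_with_half[OF J(1-3)] by blast
    obtain M where M: "matching G M" "card M = card T + h" "\<Union>M \<subseteq> T \<union> m ` T \<union> (L - {v})"
      by (rule matching_from_injection[OF inj_m insertI2[OF m_in] m_adj v])
    have "v \<notin> T \<union> m ` T \<union> (L - {v})" using v m_in disj by blast
    then have "v \<notin> \<Union>M" by (rule contra_subsetD[OF M(3)])
    then have "\<exists>M. matching G M \<and> card M = matching_number G \<and> v \<notin> \<Union>M"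
      using M(1,2) matching_number_eq by metis
    with S show ?thesis using K[of v] v verts_eq by blast
  qed
  have notT: "v \<notin> ?K" if v: "v \<in> T" for v
  proof
    assume "v \<in> ?K"
    then obtain M where M: "matching G M" "card M = matching_number G" "v \<notin> \<Union>M"
      using K[of v] v verts_eq by blast
    have "card M \<le> card (T - {v}) + h"
    proof (rule card_matching_le_cover[OF M(1)])
      fix e assume e: "e \<in> M"
      then have "v \<notin> e" using M(3) by blast
      then show "e \<inter> (T - {v}) \<noteq> {} \<or> e \<subseteq> L" using edge_meets_T_or_in_L[OF M(1) e] by blast
    qed simp
    moreover have "card (T - {v}) < card T" using v by (intro card_Diff1_less) auto
    ultimately show False using M(2) matching_number_eq by linarith
  qed
  have unmatched: "v \<notin> ?K" if v: "v \<in> Z" "v \<notin> m ` T" for v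
  proof
    assume "v \<in> ?K"
    then obtain S where "independent_set G S" "card S = independence_number G" "v \<notin> S"
      using K[of v] v verts_eq by blast
    then show False using maximum_independent_set_cases[OF _ _ v(1)] v(2) by blast
  qed
  have matched: "m t \<in> ?K \<longleftrightarrow> t \<in> corona G - diadem G" if t: "t \<in> T" for t
  proof -
    have mt: "m t \<in> verts G" using m_in[OF t] verts_eq by blast
    have "(\<exists>M. matching G M \<and> card M = matching_number G \<and> m t \<notin> \<Union>M) \<longleftrightarrow> t \<notin> diadem G"
      if cor: "t \<in> corona G"
    proof
      assume "\<exists>M. matching G M \<and> card M = matching_number G \<and> m t \<notin> \<Union>M"
      then show "t \<notin> diadem G" using not_avoidable_by_matching[OF t] by blast
    next
      assume "t \<notin> diadem G"
      then obtain M where "matching G M" "card M = matching_number G" "m t \<notin> \<Union>M"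
        using avoidable_by_matching[OF t cor] by blast
      then show "\<exists>M. matching G M \<and> card M = matching_number G \<and> m t \<notin> \<Union>M" by blast
    qed
    then show ?thesis using K[OF mt] avoidable_by_independent_iff[OF t] by blast
  qed
  show ?thesis
  proof (rule set_eqI)
    fix v
    consider "v \<in> L" | "v \<in> T" | "v \<in> Z" "v \<notin> m ` T" | t where "t \<in> T" "v = m t" | "v \<notin> verts G"
      using verts_eq by blast
    then show "v \<in> ?K \<longleftrightarrow> v \<in> L \<union> m ` (T \<inter> corona G - diadem G)"
    proof cases
      case 1
      then show ?thesis using inL by blast
    next
      case 2
      moreover have "v \<notin> L" "v \<notin> m ` T" using 2 m_in disj by blast+
      ultimately show ?thesis using notT by blast
    next
      case 3
      moreover have "v \<notin> L" using 3 disj by blast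
      ultimately show ?thesis using unmatched by blast
    next
      case (4 t)
      have "v \<notin> L" using 4 m_in disj by blast
      moreover have "v \<in> m ` (T \<inter> corona G - diadem G) \<longleftrightarrow> t \<in> T \<inter> corona G - diadem G"
        unfolding 4(2) by (rule inj_on_image_mem_iff[OF inj_m 4(1)]) blast
      moreover have "v \<in> ?K \<longleftrightarrow> t \<in> corona G - diadem G"
        using matched[OF 4(1)] unfolding 4(2) .
      ultimately show ?thesis using 4(1) by (simp only: Un_iff) blast
    next
      case 5
      moreover have "L \<union> m ` T \<subseteq> verts G" using verts_eq m_in by blast
      ultimately show ?thesis by blast
    qed
  qed
qed

lemma rho_v_eq: "int (rho_v G) = int (card (corona G)) - int (card (diadem G))"
proof -
  let ?A = "T \<inter> corona G" and ?B = "T \<inter> diadem G"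
  have BA: "?B \<subseteq> ?A" using diadem_subset_corona by blast
  have "rho_v G = card (L \<union> m ` (?A - diadem G))"
    unfolding rho_v_def konig_egervary_deletions ..
  also have "\<dots> = card L + card (m ` (?A - diadem G))"
    using m_in disj by (intro card_Un_disjoint) auto
  also have "card (m ` (?A - diadem G)) = card (?A - diadem G)" by (rule card_m_image) blast
  also have "?A - diadem G = ?A - ?B" by blast
  also have "card (?A - ?B) = card ?A - card ?B" using BA by (intro card_Diff_subset) auto
  finally have rho: "rho_v G = card L + (card ?A - card ?B)" .
  have "card (corona G) = card (Z \<union> L \<union> ?A)" using corona_eq by simp
  also have "\<dots> = card (Z \<union> L) + card ?A" using disj by (intro card_Un_disjoint) auto
  also have "card (Z \<union> L) = card Z + card L" using disj by (intro card_Un_disjoint) auto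
  finally have cor: "card (corona G) = card Z + card L + card ?A" .
  have "card (diadem G) = card (Z \<union> ?B)" using diadem_eq by simp
  also have "\<dots> = card Z + card ?B" using disj by (intro card_Un_disjoint) auto
  finally have dia: "card (diadem G) = card Z + card ?B" .
  have "card ?B \<le> card ?A" using BA by (intro card_mono) auto
  then show ?thesis using rho cor dia by linarith
qed

end

section \<open>Existence of the decomposition\<close>

context graph
begin

text \<open>
  If \<open>J \<subseteq> N(Z)\<close> had fewer than \<open>|J|\<close> neighbours in \<open>Z\<close>, removing these from \<open>Z\<close> would increase the
  difference.
\<close>
lemma critical_set_saturates_nbhd:
  assumes "critical_independent_set G Z"
  obtains m where "inj_on m (nbhd G Z)" "\<forall>t\<in>nbhd G Z. m t \<in> Z \<and> t \<rightarrow>\<^bsub>G\<^esub> m t"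
proof -
  have ind: "independent_set G Z" and dZ: "difference G Z = critical_difference G"
    using assms by (simp_all add: critical_independent_set_def)
  have finZ: "finite Z" using ind by (rule finite_independent_set)
  define N where "N t = {z \<in> Z. t \<rightarrow>\<^bsub>G\<^esub> z}" for t
  have "\<exists>m. inj_on m (nbhd G Z) \<and> (\<forall>t\<in>nbhd G Z. m t \<in> N t)"
  proof (rule hall)
    show "finite (N t)" for t using finZ by (simp add: N_def)
    fix J assume J: "J \<subseteq> nbhd G Z"
    define U where "U = \<Union> (N ` J)"
    have UZ: "U \<subseteq> Z" unfolding U_def N_def by blast
    have "nbhd G (Z - U) \<subseteq> nbhd G Z - J"
    proof
      fix v assume "v \<in> nbhd G (Z - U)"
      then obtain z where z: "z \<in> Z" "z \<notin> U" "v \<rightarrow>\<^bsub>G\<^esub> z" by (auto simp: nbhd_iff)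
      have "v \<notin> J"
      proof
        assume "v \<in> J"
        moreover have "z \<in> N v" using z by (simp add: N_def)
        ultimately have "z \<in> U" unfolding U_def by (rule UN_I)
        then show False using z(2) by blast
      qed
      then show "v \<in> nbhd G Z - J" using z(1,3) by (auto simp: nbhd_iff)
    qed
    then have "card (nbhd G (Z - U)) \<le> card (nbhd G Z - J)" by (intro card_mono) simp_all
    also have "\<dots> = card (nbhd G Z) - card J"
      using J by (intro card_Diff_subset finite_subset[OF J]) simp_all
    finally have 1: "card (nbhd G (Z - U)) \<le> card (nbhd G Z) - card J" .
    have 2: "card J \<le> card (nbhd G Z)" using J by (intro card_mono) simp_all
    have 3: "card (Z - U) = card Z - card U"
      using UZ finZ by (intro card_Diff_subset finite_subset[OF UZ])
    have 4: "card U \<le> card Z" using UZ finZ by (intro card_mono)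
    have "difference G (Z - U) \<le> difference G Z"
      unfolding dZ using ind
      by (intro difference_le_critical_difference independent_set_subset[OF ind]) blast
    then show "card J \<le> card (\<Union> (N ` J))"
      unfolding U_def[symmetric] difference_def using 1 2 3 4 by linarith
  qed simp
  then obtain m where "inj_on m (nbhd G Z)" "\<forall>t\<in>nbhd G Z. m t \<in> N t" by blast
  then show ?thesis by (intro that[of m]) (auto simp: N_def)
qed

text \<open>
  Otherwise \<open>Z \<union> I\<close> would be independent with at least the difference of \<open>Z\<close>, hence a larger critical
  set.
\<close>
lemma expanding_outside_largest_critical_set:
  assumes Z: "critical_independent_set G Z"
    and largest: "\<And>A. critical_independent_set G A \<Longrightarrow> card A \<le> card Z"
    and I: "independent_set G I" "I \<subseteq> verts G - Z - nbhd G Z" "I \<noteq> {}"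
  shows "card I < card (nbhd G I \<inter> (verts G - Z - nbhd G Z))"
proof (rule ccontr)
  let ?L = "verts G - Z - nbhd G Z"
  assume "\<not> card I < card (nbhd G I \<inter> ?L)"
  then have le: "card (nbhd G I \<inter> ?L) \<le> card I" by simp
  have ind: "independent_set G Z" and dZ: "difference G Z = critical_difference G"
    using Z by (simp_all add: critical_independent_set_def)
  have fin: "finite Z" "finite I" using ind I(1) finite_independent_set by blast+
  have noadj: "\<not> x \<rightarrow>\<^bsub>G\<^esub> z \<and> \<not> z \<rightarrow>\<^bsub>G\<^esub> x" if "x \<in> I" "z \<in> Z" for x z
    using that I(2) adj_sym unfolding nbhd_def by blast
  have indA: "independent_set G (Z \<union> I)"
    using ind I(1) noadj unfolding independent_set_def by blast
  have "nbhd G (Z \<union> I) \<subseteq> nbhd G Z \<union> (nbhd G I \<inter> ?L)"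
  proof
    fix v assume v: "v \<in> nbhd G (Z \<union> I)"
    show "v \<in> nbhd G Z \<union> (nbhd G I \<inter> ?L)"
    proof (cases "v \<in> nbhd G Z")
      case False
      then obtain x where x: "x \<in> I" "v \<rightarrow>\<^bsub>G\<^esub> x" using v by (auto simp: nbhd_iff)
      then have "v \<notin> Z" using noadj by blast
      moreover have "v \<in> verts G" using adj_in_verts[OF x(2)] by blast
      moreover have "v \<in> nbhd G I" using x by (auto simp: nbhd_iff)
      ultimately show ?thesis using False by blast
    qed blast
  qed
  then have "card (nbhd G (Z \<union> I)) \<le> card (nbhd G Z \<union> (nbhd G I \<inter> ?L))"
    by (intro card_mono) simp_all
  also have "\<dots> \<le> card (nbhd G Z) + card (nbhd G I \<inter> ?L)" by (rule card_Un_le)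
  finally have cN: "card (nbhd G (Z \<union> I)) \<le> card (nbhd G Z) + card I" using le by linarith
  have cA: "card (Z \<union> I) = card Z + card I"
    using fin I(2) by (intro card_Un_disjoint) blast+
  have "critical_difference G \<le> difference G (Z \<union> I)"
    unfolding dZ[symmetric] difference_def using cN cA by linarith
  then have "critical_independent_set G (Z \<union> I)"
    using indA difference_le_critical_difference[OF indA] by (simp add: critical_independent_set_def)
  then have "card I = 0" using largest[of "Z \<union> I"] cA by linarith
  then show False using I(3) fin(2) by simp
qed

text \<open>
  The neighbours of one colour class lie in the other, so each nonempty class would be strictly smaller
  than the other.
\<close>
lemma expanding_set_bipartite_empty:
  assumes L: "expanding_set L"
    and \<chi>: "\<And>u v. u \<in> L \<Longrightarrow> v \<in> L \<Longrightarrow> u \<rightarrow>\<^bsub>G\<^esub> v \<Longrightarrow> \<chi> u \<noteq> (\<chi> v :: bool)"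
  shows "L = {}"
proof -
  have side: "card {v \<in> L. \<chi> v = b} < card {v \<in> L. \<chi> v = (\<not> b)}" if "{v \<in> L. \<chi> v = b} \<noteq> {}" for b
  proof -
    have "independent_set G {v \<in> L. \<chi> v = b}"
      using L \<chi> by (auto simp: expanding_set_def independent_set_def)
    then have "card {v \<in> L. \<chi> v = b} < card (nbhd G {v \<in> L. \<chi> v = b} \<inter> L)"
      using that by (intro expanding_setD[OF L]) auto
    also have "\<dots> \<le> card {v \<in> L. \<chi> v = (\<not> b)}"
      using \<chi> expanding_set_finite[OF L] by (intro card_mono) (auto simp: nbhd_iff)
    finally show ?thesis .
  qed
  have "{v \<in> L. \<chi> v = b} = {}" for b
  proof (rule ccontr)
    assume ne: "{v \<in> L. \<chi> v = b} \<noteq> {}"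
    from side[OF this] have "{v \<in> L. \<chi> v = (\<not> b)} \<noteq> {}" by (intro notI) simp
    from side[OF this] side[OF ne] show False by simp
  qed
  then show ?thesis by blast
qed

text \<open>
  \<open>P\<close> and \<open>Q\<close> are the colour classes of a two-colouring of the graph induced on \<open>L\<close> with the edge \<open>e\<close>
  removed, and \<open>e\<close> lies in \<open>P\<close>.
\<close>
definition near_bipartition :: "'a set \<Rightarrow> 'a set \<Rightarrow> 'a set \<Rightarrow> 'a set \<Rightarrow> bool" where
  "near_bipartition L e P Q \<longleftrightarrow> P \<union> Q = L \<and> P \<inter> Q = {} \<and> independent_set G Q \<and>
    e \<in> uedges G \<and> e \<subseteq> P \<and> (\<forall>u\<in>P. \<forall>v\<in>P. u \<rightarrow>\<^bsub>G\<^esub> v \<longrightarrow> {u, v} = e)"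

lemma near_bipartitionD:
  assumes "near_bipartition L e P Q"
  shows "P \<union> Q = L" "P \<inter> Q = {}" "independent_set G Q" "e \<in> uedges G" "e \<subseteq> P"
    and "\<And>u v. u \<in> P \<Longrightarrow> v \<in> P \<Longrightarrow> u \<rightarrow>\<^bsub>G\<^esub> v \<Longrightarrow> {u, v} = e"
  using assms unfolding near_bipartition_def by simp_all

text \<open>
  The colouring restricted to \<open>L\<close> cannot be proper, because a nonempty expanding set is not bipartite.
  So the only edge that may be monochromatic lies in \<open>L\<close>.
\<close>
lemma near_bipartition_from_colouring:
  fixes \<chi> :: "'a \<Rightarrow> bool"
  assumes L: "expanding_set L" "L \<noteq> {}" and e: "e \<in> uedges G"
    and \<chi>: "\<And>u v. u \<rightarrow>\<^bsub>G\<^esub> v \<Longrightarrow> \<chi> u = \<chi> v \<Longrightarrow> {u, v} = e"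
  obtains P Q where "near_bipartition L e P Q"
proof -
  obtain u v where uv: "u \<in> L" "v \<in> L" "u \<rightarrow>\<^bsub>G\<^esub> v" "\<chi> u = \<chi> v"
    using expanding_set_bipartite_empty[OF L(1), of \<chi>] L(2) by blast
  then have euv: "e = {u, v}" using \<chi> by simp
  let ?P = "{w \<in> L. \<chi> w = \<chi> u}" and ?Q = "{w \<in> L. \<chi> w \<noteq> \<chi> u}"
  have "\<not> a \<rightarrow>\<^bsub>G\<^esub> b" if "a \<in> ?Q" "b \<in> ?Q" for a b
  proof
    assume "a \<rightarrow>\<^bsub>G\<^esub> b"
    moreover have "\<chi> a = \<chi> b" using that by simp
    ultimately have "{a, b} = {u, v}" using \<chi> euv by blast
    then have "a = u \<or> a = v" by (auto simp: doubleton_eq_iff)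
    then show False using that(1) uv(4) by auto
  qed
  then have "independent_set G ?Q"
    using L(1) unfolding independent_set_def expanding_set_def by blast
  moreover have "\<forall>a\<in>?P. \<forall>b\<in>?P. a \<rightarrow>\<^bsub>G\<^esub> b \<longrightarrow> {a, b} = e" using \<chi> by simp
  moreover have "e \<subseteq> ?P" using uv euv by simp
  moreover have "?P \<union> ?Q = L" "?P \<inter> ?Q = {}" by auto
  ultimately have "near_bipartition L e ?P ?Q" unfolding near_bipartition_def using e by simp
  then show ?thesis by (rule that)
qed

lemma near_bipartition_independent_side:
  assumes nb: "near_bipartition L e P Q" and L: "L \<subseteq> verts G" and x: "x \<in> e"
  shows "independent_set G (P - {x})"
proof -
  have "\<not> u \<rightarrow>\<^bsub>G\<^esub> v" if "u \<in> P - {x}" "v \<in> P - {x}" for u v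
  proof
    assume "u \<rightarrow>\<^bsub>G\<^esub> v"
    then have "{u, v} = e" using near_bipartitionD(6)[OF nb] that by simp
    then show False using x that by auto
  qed
  moreover have "P - {x} \<subseteq> verts G" using near_bipartitionD(1)[OF nb] L by blast
  ultimately show ?thesis unfolding independent_set_def by simp
qed

text \<open>
  Expansion is applied to the independent sets \<open>Q\<close> and \<open>P - {x}\<close>, where \<open>x\<close> is an end of \<open>e\<close>: the
  neighbours of \<open>Q\<close> lie in \<open>P\<close>, and those of \<open>P - {x}\<close> lie in \<open>Q \<union> {x}\<close>.
\<close>
lemma near_bipartition_card:
  assumes L: "expanding_set L" and nb: "near_bipartition L e P Q"
  shows "card P = Suc (card Q)"
proof -
  note PQ = near_bipartitionD(1,2)[OF nb] and Q = near_bipartitionD(3)[OF nb]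
    and inP = near_bipartitionD(6)[OF nb]
  have finL: "finite L" and LV: "L \<subseteq> verts G"
    using expanding_set_finite[OF L] L unfolding expanding_set_def by blast+
  then have fin: "finite P" "finite Q" using PQ(1) by auto
  obtain x y where xy: "x \<rightarrow>\<^bsub>G\<^esub> y" "e = {x, y}"
    using near_bipartitionD(4)[OF nb] unfolding uedges_iff by blast
  have xyP: "x \<in> P" "y \<in> P" using near_bipartitionD(5)[OF nb] xy(2) by simp_all
  have "x \<noteq> y" using xy(1) adj_irrefl by blast
  have "card Q < card P"
  proof (cases "Q = {}")
    case True
    moreover have "card P > 0" using card_gt_0_iff[of P] xyP(1) fin(1) by blast
    ultimately show ?thesis by simp
  next
    case False
    have "card Q < card (nbhd G Q \<inter> L)" using PQ(1) False by (intro expanding_setD[OF L Q]) auto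
    also have "\<dots> \<le> card P"
    proof (rule card_mono[OF fin(1)])
      have "v \<notin> Q" if "v \<in> nbhd G Q" for v
        using that Q by (auto simp: nbhd_iff independent_set_def)
      then show "nbhd G Q \<inter> L \<subseteq> P" using PQ(1) by blast
    qed
    finally show ?thesis .
  qed
  moreover have "card (P - {x}) < Suc (card Q)"
  proof -
    have "card (P - {x}) < card (nbhd G (P - {x}) \<inter> L)"
    proof (rule expanding_setD[OF L near_bipartition_independent_side[OF nb LV]])
      show "x \<in> e" using xy(2) by simp
      show "P - {x} \<subseteq> L" using PQ(1) by blast
      show "P - {x} \<noteq> {}" using xyP(2) \<open>x \<noteq> y\<close> by blast
    qed
    also have "\<dots> \<le> card (insert x Q)"
    proof (rule card_mono)
      show "nbhd G (P - {x}) \<inter> L \<subseteq> insert x Q"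
      proof
        fix v assume v: "v \<in> nbhd G (P - {x}) \<inter> L"
        then obtain p where p: "p \<in> P" "p \<noteq> x" "v \<rightarrow>\<^bsub>G\<^esub> p" by (auto simp: nbhd_iff)
        show "v \<in> insert x Q"
        proof (cases "v \<in> P")
          case True
          then have "{v, p} = {x, y}" using inP[OF _ p(1,3)] xy(2) by simp
          then show ?thesis using p(2) by (auto simp: doubleton_eq_iff)
        next
          case False
          then show ?thesis using v PQ(1) by blast
        qed
      qed
    qed (use fin in simp)
    also have "\<dots> \<le> Suc (card Q)" using fin(2) by (simp add: card_insert_if)
    finally show ?thesis .
  qed
  moreover have "card P = Suc (card (P - {x}))" using card_Suc_Diff1[OF fin(1) xyP(1)] by simp
  ultimately show ?thesis by linarith
qed

text \<open>
  Strict expansion of the subsets of \<open>Q\<close> leaves Hall's condition intact when one vertex of \<open>P\<close> is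
  removed.
\<close>
lemma near_bipartition_matching:
  assumes L: "expanding_set L" and nb: "near_bipartition L e P Q" and c: "c \<in> P"
  obtains M where "matching G M" "\<Union>M \<subseteq> L - {c}" "card M = card Q"
proof -
  note PQ = near_bipartitionD(1,2)[OF nb] and Q = near_bipartitionD(3)[OF nb]
  have fin: "finite P" "finite Q" using expanding_set_finite[OF L] PQ(1) by auto
  define N where "N q = {p \<in> P - {c}. q \<rightarrow>\<^bsub>G\<^esub> p}" for q
  have "\<exists>g. inj_on g Q \<and> (\<forall>q\<in>Q. g q \<in> N q)"
  proof (rule hall)
    show "finite (N q)" for q using fin by (simp add: N_def)
    show "card J \<le> card (\<Union> (N ` J))" if J: "J \<subseteq> Q" for J
    proof (cases "J = {}")
      case False
      have "card J < card (nbhd G J \<inter> L)"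
        using PQ(1) J by (intro expanding_setD[OF L independent_set_subset[OF Q J] _ False]) blast
      also have "\<dots> \<le> Suc (card (nbhd G J \<inter> L - {c}))" by (rule card_le_Suc_card_remove)
      finally have "card J \<le> card (nbhd G J \<inter> L - {c})" by simp
      also have "\<dots> \<le> card (\<Union> (N ` J))"
      proof (rule card_mono)
        show "finite (\<Union> (N ` J))" using fin finite_subset[OF J] by (simp add: N_def)
        show "nbhd G J \<inter> L - {c} \<subseteq> \<Union> (N ` J)"
        proof
          fix v assume v: "v \<in> nbhd G J \<inter> L - {c}"
          then obtain j where j: "j \<in> J" "v \<rightarrow>\<^bsub>G\<^esub> j" by (auto simp: nbhd_iff)
          have "v \<notin> Q" using j J Q by (auto simp: independent_set_def)
          then have "v \<in> N j" using v PQ(1) adj_sym[OF j(2)] by (auto simp: N_def)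
          with j(1) show "v \<in> \<Union> (N ` J)" by (rule UN_I)
        qed
      qed
      finally show ?thesis .
    qed simp
  qed (rule fin)
  then obtain g where g: "inj_on g Q" "\<And>q. q \<in> Q \<Longrightarrow> g q \<in> N q" by blast
  have gP: "g q \<in> P - {c}" and adj: "q \<rightarrow>\<^bsub>G\<^esub> g q" if "q \<in> Q" for q
    using g(2)[OF that] by (simp_all add: N_def)
  have "Q \<inter> g ` Q = {}" using gP PQ(2) by blast
  note M = matching_of_injection[OF g(1) adj this]
  have "\<Union>((\<lambda>q. {q, g q}) ` Q) \<subseteq> L - {c}" using gP PQ c by blast
  with M show ?thesis by (intro that)
qed

text \<open>
  Let \<open>W\<close> consist of the vertices that are in \<open>Q e\<close> for all \<open>e\<close>. Its neighbours in \<open>L\<close> are in \<open>P e\<close> for all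
  \<open>e\<close>, and no vertex of an edge \<open>e \<in> F\<close> has this property: it is adjacent to an end of another edge
  \<open>e'\<close> that does not contain it, so it lies in \<open>Q e'\<close>. Hence these neighbours form an independent set
  \<open>W'\<close> whose neighbours in \<open>L\<close> are again in \<open>W\<close>, and expansion of both \<open>W\<close> and \<open>W'\<close> would give
  \<open>|W| < |W'| < |W|\<close>.
\<close>
lemma every_vertex_on_larger_side:
  assumes L: "expanding_set L" and F: "F \<noteq> {}"
    and nb: "\<And>e. e \<in> F \<Longrightarrow> near_bipartition L e (P e) (Q e)"
    and next_edge: "\<And>e x. e \<in> F \<Longrightarrow> x \<in> e \<Longrightarrow> \<exists>e'\<in>F. x \<notin> e' \<and> (\<exists>y\<in>e'. x \<rightarrow>\<^bsub>G\<^esub> y)"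
    and c: "c \<in> L"
  shows "\<exists>e\<in>F. c \<in> P e"
proof (rule ccontr)
  have PQ: "v \<in> P e \<or> v \<in> Q e" if "e \<in> F" "v \<in> L" for e v
    using near_bipartitionD(1)[OF nb[OF that(1)]] that(2) by blast
  have Q: "\<not> u \<rightarrow>\<^bsub>G\<^esub> v" if "e \<in> F" "u \<in> Q e" "v \<in> Q e" for e u v
    using near_bipartitionD(3)[OF nb[OF that(1)]] that(2,3) by (simp add: independent_set_def)
  have P: "{u, v} = e" if "e \<in> F" "u \<in> P e" "v \<in> P e" "u \<rightarrow>\<^bsub>G\<^esub> v" for e u v
    using near_bipartitionD(6)[OF nb[OF that(1)]] that(2-4) by simp
  have eP: "y \<in> P e" if "e \<in> F" "y \<in> e" for e y
    using near_bipartitionD(5)[OF nb[OF that(1)]] that(2) by blast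
  define W where "W = {v \<in> L. \<forall>e\<in>F. v \<in> Q e}"
  define W' where "W' = nbhd G W \<inter> L"
  assume "\<not> (\<exists>e\<in>F. c \<in> P e)"
  then have "c \<in> W" unfolding W_def using PQ c by blast
  then have "W \<noteq> {}" by blast
  have LV: "L \<subseteq> verts G" using L by (simp add: expanding_set_def)
  have fin: "finite W" "finite W'" using expanding_set_finite[OF L] by (simp_all add: W_def W'_def)
  obtain e0 where e0: "e0 \<in> F" using F by blast
  have "independent_set G W"
    unfolding independent_set_def using Q[OF e0] LV e0 unfolding W_def by blast
  then have "card W < card W'"
    unfolding W'_def using \<open>W \<noteq> {}\<close> by (intro expanding_setD[OF L]) (auto simp: W_def)
  have W'P: "v \<in> P e" if v: "v \<in> W'" and e: "e \<in> F" for v e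
  proof -
    obtain w where w: "w \<in> W" "v \<rightarrow>\<^bsub>G\<^esub> w" "v \<in> L" using v by (auto simp: W'_def nbhd_iff)
    have "w \<in> Q e" using w(1) e by (simp add: W_def)
    then have "v \<notin> Q e" using Q[OF e] w(2) by blast
    then show ?thesis using PQ[OF e w(3)] by blast
  qed
  have off: "v \<notin> e" if v: "v \<in> W'" and e: "e \<in> F" for v e
  proof
    assume "v \<in> e"
    then obtain e' y where e': "e' \<in> F" "v \<notin> e'" "y \<in> e'" "v \<rightarrow>\<^bsub>G\<^esub> y"
      using next_edge[OF e] by blast
    have "{v, y} = e'" using P[OF e'(1) W'P[OF v e'(1)] eP[OF e'(1,3)] e'(4)] .
    then show False using e'(2) by blast
  qed
  have "\<not> u \<rightarrow>\<^bsub>G\<^esub> v" if "u \<in> W'" "v \<in> W'" for u v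
  proof
    assume "u \<rightarrow>\<^bsub>G\<^esub> v"
    then have "{u, v} = e0" using P[OF e0 W'P[OF that(1) e0] W'P[OF that(2) e0]] by blast
    then show False using off[OF that(1) e0] by blast
  qed
  then have "independent_set G W'" using LV unfolding independent_set_def W'_def by blast
  moreover have "W' \<noteq> {}" using \<open>card W < card W'\<close> by (intro notI) simp
  ultimately have "card W' < card (nbhd G W' \<inter> L)"
    by (intro expanding_setD[OF L]) (auto simp: W'_def)
  also have "\<dots> \<le> card W"
  proof (rule card_mono[OF fin(1)])
    show "nbhd G W' \<inter> L \<subseteq> W"
    proof
      fix w assume w: "w \<in> nbhd G W' \<inter> L"
      then obtain v where v: "v \<in> W'" "w \<rightarrow>\<^bsub>G\<^esub> v" by (auto simp: nbhd_iff)
      have "w \<in> Q e" if e: "e \<in> F" for e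
      proof (rule ccontr)
        assume "w \<notin> Q e"
        then have "w \<in> P e" using PQ[OF e] w by blast
        then have "{w, v} = e" using P[OF e _ W'P[OF v(1) e] v(2)] by blast
        then show False using off[OF v(1) e] by blast
      qed
      then show "w \<in> W" using w by (simp add: W_def)
    qed
  qed
  finally show False using \<open>card W < card W'\<close> by simp
qed

lemma konig_egervary_if_saturated:
  assumes Z: "independent_set G Z" and m: "inj_on m T" "\<And>t. t \<in> T \<Longrightarrow> m t \<in> Z"
    "\<And>t. t \<in> T \<Longrightarrow> t \<rightarrow>\<^bsub>G\<^esub> m t"
    and disj: "Z \<inter> T = {}" and V: "verts G = Z \<union> T"
  shows "konig_egervary G"
proof -
  have "T \<inter> m ` T = {}" using m(2) disj by blast
  note M = matching_of_injection[OF m(1,3) this]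
  have fin: "finite Z" "finite T" using finite_verts unfolding V by simp_all
  have "card (verts G) = card Z + card T" unfolding V using fin disj by (intro card_Un_disjoint)
  then have "card (verts G) \<le> independence_number G + matching_number G"
    using card_independent_set_le[OF Z] card_matching_le[OF M(1)] M(2) by linarith
  then show ?thesis
    unfolding konig_egervary_def using independence_number_plus_matching_number_le by linarith
qed

lemma decomposition_exists:
  assumes notKE: "\<not> konig_egervary G" and ab: "almost_bipartite G"
  obtains Z T L m h where "odd_core_decomposition G Z T L m h"
proof -
  have finC: "finite {A. critical_independent_set G A}"
    by (rule finite_subset[OF _ finite_independent_sets]) (auto simp: critical_independent_set_def)
  define k where "k = Max (card ` {A. critical_independent_set G A})"
  have "k \<in> card ` {A. critical_independent_set G A}"
    unfolding k_def using finC critical_independent_set_exists by (intro Max_in) auto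
  then obtain Z where Z: "critical_independent_set G Z" and Zk: "card Z = k" by blast
  have largest: "card A \<le> card Z" if "critical_independent_set G A" for A
    unfolding Zk k_def using finC that by (intro Max_ge) simp_all
  have indZ: "independent_set G Z" using Z by (simp add: critical_independent_set_def)
  define T where "T = nbhd G Z"
  define L where "L = verts G - Z - T"
  have TV: "T \<subseteq> verts G" unfolding T_def by (auto simp: nbhd_iff adj_in_verts)
  have ZV: "Z \<subseteq> verts G" using indZ by (simp add: independent_set_def)
  have ZT: "Z \<inter> T = {}"
    unfolding T_def using indZ by (auto simp: nbhd_iff independent_set_def)
  obtain m where injm: "inj_on m T" and mT: "\<forall>t\<in>T. m t \<in> Z \<and> t \<rightarrow>\<^bsub>G\<^esub> m t"
    unfolding T_def by (rule critical_set_saturates_nbhd[OF Z])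
  have m: "inj_on m T" "\<And>t. t \<in> T \<Longrightarrow> m t \<in> Z" "\<And>t. t \<in> T \<Longrightarrow> t \<rightarrow>\<^bsub>G\<^esub> m t"
    using injm mT by simp_all
  have expL: "expanding_set L"
    unfolding expanding_set_def
  proof (intro conjI allI impI)
    show "L \<subseteq> verts G" unfolding L_def by blast
    fix I assume I: "independent_set G I" "I \<subseteq> L" "I \<noteq> {}"
    show "card I < card (nbhd G I \<inter> L)"
      using expanding_outside_largest_critical_set[OF Z largest I(1) _ I(3)] I(2)
      unfolding L_def T_def by blast
  qed
  have Lne: "L \<noteq> {}"
  proof
    assume "L = {}"
    then have "verts G = Z \<union> T" using TV ZV unfolding L_def by blast
    then show False using konig_egervary_if_saturated[OF indZ m ZT] notKE by blast
  qed
  obtain F where F: "F \<noteq> {}"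
    and F_edge: "F \<subseteq> uedges G"
    and F_col: "\<forall>e\<in>F. \<exists>\<chi>::'a \<Rightarrow> bool. \<forall>u v. u \<rightarrow>\<^bsub>G\<^esub> v \<longrightarrow> \<chi> u = \<chi> v \<longrightarrow> {u, v} = e"
    and F_next: "\<forall>e\<in>F. \<forall>x\<in>e. \<exists>e'\<in>F. x \<notin> e' \<and> (\<exists>y\<in>e'. x \<rightarrow>\<^bsub>G\<^esub> y)"
    by (rule unique_odd_cycle_structure[OF ab])
  have ex: "\<exists>PQ. near_bipartition L e (fst PQ) (snd PQ)" if e: "e \<in> F" for e
  proof -
    obtain \<chi> :: "'a \<Rightarrow> bool" where \<chi>: "\<forall>u v. u \<rightarrow>\<^bsub>G\<^esub> v \<longrightarrow> \<chi> u = \<chi> v \<longrightarrow> {u, v} = e"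
      using bspec[OF F_col e] by (elim exE)
    have eE: "e \<in> uedges G" using F_edge e by blast
    obtain P Q where "near_bipartition L e P Q"
    proof (rule near_bipartition_from_colouring[OF expL Lne eE])
      fix u v assume "u \<rightarrow>\<^bsub>G\<^esub> v" "\<chi> u = \<chi> v"
      then show "{u, v} = e" using \<chi> by simp
    qed
    then show ?thesis by (intro exI[of _ "(P, Q)"]) simp
  qed
  define PQ where "PQ e = (SOME PQ. near_bipartition L e (fst PQ) (snd PQ))" for e
  define P Q where "P e = fst (PQ e)" and "Q e = snd (PQ e)" for e
  have nb: "near_bipartition L e (P e) (Q e)" if "e \<in> F" for e
    unfolding P_def Q_def PQ_def by (rule someI_ex[OF ex[OF that]])
  obtain e0 where e0: "e0 \<in> F" using F by blast
  define h where "h = card (Q e0)"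
  have finL: "finite L" using expanding_set_finite[OF expL] .
  have cL: "card L = card (P e) + card (Q e)" if "e \<in> F" for e
  proof -
    note PQe = near_bipartitionD(1,2)[OF nb[OF that]]
    have "finite (P e)" "finite (Q e)" using finL PQe(1) by auto
    then show ?thesis using PQe card_Un_disjoint by metis
  qed
  have Ph: "card (P e) = Suc (card (Q e))" if "e \<in> F" for e
    using near_bipartition_card[OF expL nb[OF that]] .
  have cardL: "card L = Suc (2 * h)" using cL[OF e0] Ph[OF e0] unfolding h_def by simp
  have Qh: "card (Q e) = h" if "e \<in> F" for e
    using cL[OF that] Ph[OF that] cardL by simp
  have LV: "L \<subseteq> verts G" unfolding L_def by blast
  have half: "\<exists>I. independent_set G I \<and> I \<subseteq> L \<and> card I = h \<and> c \<in> I" if c: "c \<in> L" for c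
  proof (cases "c \<in> Q e0")
    case True
    then show ?thesis
      using near_bipartitionD(1,3)[OF nb[OF e0]] Qh[OF e0] by blast
  next
    case False
    then have cP: "c \<in> P e0" using near_bipartitionD(1)[OF nb[OF e0]] c by blast
    obtain x y where xy: "x \<rightarrow>\<^bsub>G\<^esub> y" "e0 = {x, y}" using F_edge e0 unfolding uedges_iff[symmetric] by (meson subsetD uedges_iff)
    then have "x \<noteq> y" using adj_irrefl by blast
    then obtain z where z: "z \<in> e0" "z \<noteq> c" using xy(2) by blast
    have zP: "z \<in> P e0" using near_bipartitionD(5)[OF nb[OF e0]] z(1) by blast
    have "independent_set G (P e0 - {z})"
      by (rule near_bipartition_independent_side[OF nb[OF e0] LV z(1)])
    moreover have "P e0 - {z} \<subseteq> L" using near_bipartitionD(1)[OF nb[OF e0]] by blast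
    moreover have "card (P e0 - {z}) = h" using zP Ph[OF e0] Qh[OF e0] by simp
    moreover have "c \<in> P e0 - {z}" using cP z(2) by blast
    ultimately show ?thesis by blast
  qed
  have perfect: "\<exists>M. matching G M \<and> \<Union>M \<subseteq> L - {c} \<and> card M = h" if c: "c \<in> L" for c
  proof -
    have "\<exists>e\<in>F. c \<in> P e"
      using expL F nb F_next[rule_format] c by (rule every_vertex_on_larger_side)
    then obtain e where e: "e \<in> F" "c \<in> P e" by blast
    obtain M where "matching G M" "\<Union>M \<subseteq> L - {c}" "card M = card (Q e)"
      by (rule near_bipartition_matching[OF expL nb[OF e(1)] e(2)])
    then show ?thesis using Qh[OF e(1)] by metis
  qed
  have "odd_core_decomposition G Z T L m h"
  proof (unfold_locales)
    show "verts G = Z \<union> T \<union> L" using ZV TV unfolding L_def by blast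
    show "Z \<inter> T = {}" by (rule ZT)
    show "Z \<inter> L = {}" "T \<inter> L = {}" unfolding L_def by blast+
    show "\<not> z \<rightarrow>\<^bsub>G\<^esub> l" if "z \<in> Z" "l \<in> L" for z l
      using that adj_sym[of z l] unfolding L_def T_def by (auto simp: nbhd_iff)
  qed (fact indZ m expL cardL half perfect)+
  then show ?thesis by (rule that)
qed

end

section \<open>The vertices whose deletion gives a Koenig-Egervary graph\<close>

theorem theorem3p10:
  fixes G :: "('a,'b) pre_digraph"
  assumes "graph G"
    and "almost_bipartite G"
    and "\<not> konig_egervary G"
  shows "int (rho_v G) = int (card (corona G)) - int (card (diadem G))"
proof -
  interpret graph G by fact
  obtain Z T L m h where "odd_core_decomposition G Z T L m h"
    by (rule decomposition_exists[OF assms(3,2)])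
  then interpret odd_core_decomposition G Z T L m h .
  show ?thesis by (rule rho_v_eq)
qed

end
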